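(* Under the standing assumptions on $G_n$, $\mathcal S$ and the weights given in the context, let $\beta\in[0,\infty)$ and $\pi\sim\mathbb P_{\beta,\boldsymbol\omega}$. Then $$\frac1m W(\pi)\to-\psi'(\beta)$$ in $\mathbb P_{\beta,\boldsymbol\omega}$-probability, with high probability in $\boldsymbol\omega$; that is, for every $\varepsilon>0$, $\mathbb P_{\beta,\boldsymbol\omega}\left(\left|\tfrac1mW(\pi)+\psi'(\beta)\right|>\varepsilon\right)\to0$ in probability with respect to $\boldsymbol\omega$ as $n\to\infty$.
   Context: Graphs: $G_n=(V_n,E_n)$, $n\in\mathbb N$, is a sequence of finite undirected edge-transitive graphs with $|V_n|=c\cdot n$ for some fixed $c\in\mathbb N$ and $|E_n|=\Theta(|V_n|^2)$. Weights: $\boldsymbol\omega=\{\omega_e\}_{e\in E_n}$ are i.i.d. with a law not depending on $n$ and such that $\psi(\beta):=\log\mathbb E e^{-\beta\omega_e}<\infty$ for all $\beta\in[0,\infty)$. Weights may equal $+\infty$ with positive probability (but not almost surely), with the conventions $e^{-\beta\cdot(+\infty)}=0$ for every $\beta\ge0$ and $(+\infty)\cdot0=0$. The derivative of $\psi$ at $0$ is the right derivative; derivatives appearing in the statement are understood to exist and be finite. Optimization problem: $\mathcal S=\mathcal S(n)$ is a nonempty collection of spanning subgraphs of $G_n$, identified with their edge sets; $\widetilde{\mathcal S}$ is the collection of all subsets of elements of $\mathcal S$. A partial matching is a set of pairwise vertex-disjoint edges. $\mathbb P_0$ denotes the law of $\pi$ uniform on $\mathcal S$. It is assumed that: (1)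 all elements of $\mathcal S$ have the same number of edges $m=m(n)$, and $\lim_{n\to\infty} m^2/(2|E_n|)=\gamma\in(0,\infty)$; (2) for every partial matching $\Gamma\subseteq E_n$ there is $\pi\in\mathcal S$ with $\Gamma\subseteq\pi$; (3) there is a constant $\rho\in(0,\infty)$ (independent of $n$) such that for every $k\in\mathbb N$ and every partial matching $\Gamma$ with $k$ edges, $\left|\frac{\mathbb P_0(\Gamma\subseteq\pi)}{\prod_{e\in\Gamma}\mathbb P_0(e\in\pi)}-1\right|\le \frac{\rho^k}{\sqrt m}$; (4) there is a constant $\rho\in(0,\infty)$ (independent of $n$) such that for every $k\in\mathbb N$ and every $\Gamma\in\widetilde{\mathcal S}$ with $k$ edges that is not a partial matching, $\mathbb P_0(\Gamma\subseteq\pi)\le\rho^k\prod_{e\in\Gamma}\mathbb P_0(e\in\pi)$. Moreover $\mathbb P_0(e\in\pi)=p:=m/|E_n|$ for every $e\in E_n$. Gibbs measure: $W(\pi)=\sum_{e\in\pi}\omega_e$, $Z(\beta,\boldsymbol\omega)=\frac1{|\mathcal S|}\sum_{\pi\in\mathcal S}e^{-\beta W(\pi)}$, $\mathbb P_{\beta,\boldsymbol\omega}(\pi)=\frac{1}{Z(\beta,\boldsymbol\omega)|\mathcal S|}e^{-\beta W(\pi)}$ for $\pi\in\mathcal S$ (uniform if $Z=0$). *)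

theory Defs
  imports "HOL-Probability.Probability" "HOL-Library.Landau_Symbols"
begin

definition finite_graph :: "'v set \<Rightarrow> 'v set set \<Rightarrow> bool" where
  "finite_graph V E \<longleftrightarrow> finite V \<and> (\<forall>e\<in>E. e \<subseteq> V \<and> card e = 2)"

definition graph_automorphism :: "'v set \<Rightarrow> 'v set set \<Rightarrow> ('v \<Rightarrow> 'v) \<Rightarrow> bool" where
  "graph_automorphism V E \<phi> \<longleftrightarrow>
     bij_betw \<phi> V V \<and> (\<forall>u\<in>V. \<forall>v\<in>V. {u, v} \<in> E \<longleftrightarrow> {\<phi> u, \<phi> v} \<in> E)"

definition edge_transitive :: "'v set \<Rightarrow> 'v set set \<Rightarrow> bool" where
  "edge_transitive V E \<longleftrightarrow>
     (\<forall>e\<in>E. \<forall>f\<in>E. \<exists>\<phi>. graph_automorphism V E \<phi> \<and> \<phi> ` e = f)"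

definition partial_matching :: "'v set set \<Rightarrow> 'v set set \<Rightarrow> bool" where
  "partial_matching E \<Gamma> \<longleftrightarrow> \<Gamma> \<subseteq> E \<and> pairwise disjnt \<Gamma>"

definition subset_closure :: "'a set set \<Rightarrow> 'a set set" where
  "subset_closure S = (\<Union>\<pi>\<in>S. Pow \<pi>)"

definition uniform_prob :: "'a set \<Rightarrow> 'a set \<Rightarrow> real" where
  "uniform_prob S A = measure_pmf.prob (pmf_of_set S) A"

(* The convention exp (- b * \<infinity>) = 0 is in force for b = 0 too, so that
   boltzmann 0 x is the indicator of x < \<infinity>.  Weights lie in (-\<infinity>, \<infinity>] almost
   surely, so the value at -\<infinity> is irrelevant. *)
definition boltzmann :: "real \<Rightarrow> ereal \<Rightarrow> real" where
  "boltzmann b x = (if x = \<infinity> then 0 else exp (- (b * real_of_ereal x)))"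

definition log_laplace :: "ereal measure \<Rightarrow> real \<Rightarrow> real" where
  "log_laplace \<mu> b = ln (\<integral>x. boltzmann b x \<partial>\<mu>)"

definition total_weight :: "('e \<Rightarrow> ereal) \<Rightarrow> 'e set \<Rightarrow> ereal" where
  "total_weight w \<pi> = (\<Sum>e\<in>\<pi>. w e)"

definition partition_function :: "'e set set \<Rightarrow> real \<Rightarrow> ('e \<Rightarrow> ereal) \<Rightarrow> real" where
  "partition_function S b w = (\<Sum>\<pi>\<in>S. boltzmann b (total_weight w \<pi>)) / real (card S)"

definition gibbs_mass :: "'e set set \<Rightarrow> real \<Rightarrow> ('e \<Rightarrow> ereal) \<Rightarrow> 'e set \<Rightarrow> real" where
  "gibbs_mass S b w \<pi> =
     (if partition_function S b w = 0 then 1 / real (card S)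
      else boltzmann b (total_weight w \<pi>) / (partition_function S b w * real (card S)))"

definition gibbs_measure :: "'e set set \<Rightarrow> real \<Rightarrow> ('e \<Rightarrow> ereal) \<Rightarrow> 'e set measure" where
  "gibbs_measure S b w = point_measure S (\<lambda>\<pi>. ennreal (gibbs_mass S b w \<pi>))"

lemma prob_space_gibbs_measure:
  assumes "finite S" "S \<noteq> {}"
  shows "prob_space (gibbs_measure S b w)"
proof
  have card: "real (card S) > 0"
    using assms by (simp add: card_gt_0_iff)
  have B: "boltzmann b x \<ge> 0" for x
    by (simp add: boltzmann_def)
  have Z: "partition_function S b w \<ge> 0"
    unfolding partition_function_def by (intro divide_nonneg_nonneg sum_nonneg B) simp
  have nonneg: "gibbs_mass S b w \<pi> \<ge> 0" for \<pi>
    using B Z by (simp add: gibbs_mass_def)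
  have "(\<Sum>\<pi>\<in>S. gibbs_mass S b w \<pi>) = 1"
  proof (cases "partition_function S b w = 0")
    case True
    then show ?thesis using card by (simp add: gibbs_mass_def)
  next
    case False
    then have "(\<Sum>\<pi>\<in>S. boltzmann b (total_weight w \<pi>)) = partition_function S b w * real (card S)"
      using card by (simp add: partition_function_def)
    with False card show ?thesis
      by (simp add: gibbs_mass_def flip: sum_divide_distrib)
  qed
  then show "emeasure (gibbs_measure S b w) (space (gibbs_measure S b w)) = 1"
    unfolding gibbs_measure_def space_point_measure
    using assms nonneg by (simp add: emeasure_point_measure_finite sum_ennreal)
qed

end

theory Submission
  imports Defs
begin

text \<open>
  Write \<open>\<zeta>\<^sub>e = exp (- \<beta> \<omega>\<^sub>e) / E exp (- \<beta> \<omega>\<^sub>e) - 1\<close>. The normalised partition function is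
  \<open>N = \<Sum>\<^sub>\<Gamma> P\<^sub>0(\<Gamma> \<subseteq> \<pi>) \<Prod>\<^sub>\<Gamma> \<zeta>\<^sub>e\<close>, a sum of orthogonal terms; replacing \<open>P\<^sub>0(\<Gamma> \<subseteq> \<pi>)\<close> by \<open>p\<close> to the
  power \<open>card \<Gamma>\<close> costs \<open>o(1)\<close> in mean square and turns \<open>N\<close> into the product \<open>Y = \<Prod>\<^sub>E (1 + p \<zeta>\<^sub>e)\<close>.
  Since \<open>ln Y \<ge> p \<Sum> \<zeta>\<^sub>e - 2 p\<^sup>2 \<Sum> \<zeta>\<^sub>e\<^sup>2\<close> has bounded moments, \<open>N\<close> stays away from \<open>0\<close> with high
  probability.

  The Gibbs probability of \<open>\<bar>X\<bar> > \<epsilon>\<close>, where \<open>X = W(\<pi>) / m + D\<close>, times \<open>N\<close> has as its expectation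
  the probability of the same event under the planted law, where the weights along a uniform
  \<open>\<pi>\<close> are tilted. There \<open>E exp (- j X)\<close> is \<open>exp (m (\<psi>(\<beta> + j / m) - \<psi>(\<beta>)) - j D)\<close>, which tends
  to \<open>1\<close> for \<open>j = 1, 2\<close>. Hence \<open>E (exp (- X) - 1)\<^sup>2\<close> tends to \<open>0\<close>; this weak law of large numbers
  needs no more than the right derivative of \<open>\<psi>\<close>, and so also covers \<open>\<beta> = 0\<close>.
\<close>

section \<open>Multilinear polynomials of independent centred variables\<close>

lemma (in prob_space) indep_vars_prod_expectation:
  fixes f :: "'i \<Rightarrow> 'b \<Rightarrow> real"
  assumes "finite I" "indep_vars (\<lambda>_. N) X I"
    and f: "\<And>i. i \<in> I \<Longrightarrow> f i \<in> borel_measurable N"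
    and int: "\<And>i. i \<in> I \<Longrightarrow> integrable M (\<lambda>x. f i (X i x))"
  shows "integrable M (\<lambda>x. \<Prod>i\<in>I. f i (X i x))"
    and "expectation (\<lambda>x. \<Prod>i\<in>I. f i (X i x)) = (\<Prod>i\<in>I. expectation (\<lambda>x. f i (X i x)))"
proof -
  have "indep_vars (\<lambda>_. borel) (\<lambda>i x. f i (X i x)) I"
    by (rule indep_vars_compose2[OF assms(2)]) (use f in auto)
  then show "integrable M (\<lambda>x. \<Prod>i\<in>I. f i (X i x))"
    and "expectation (\<lambda>x. \<Prod>i\<in>I. f i (X i x)) = (\<Prod>i\<in>I. expectation (\<lambda>x. f i (X i x)))"
    using assms(1) int by (auto intro!: indep_vars_integrable indep_vars_lebesgue_integral)
qed

text \<open>Merges two monomials into a single product over distinct indices, the form to which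
  independence applies.\<close>

lemma prod_mult_prod_Un:
  fixes x :: "'i \<Rightarrow> real"
  assumes "finite A" "finite B"
  shows "(\<Prod>i\<in>A. x i) * (\<Prod>i\<in>B. x i) = (\<Prod>i\<in>A \<union> B. if i \<in> A \<inter> B then (x i)\<^sup>2 else x i)"
proof -
  have "(\<Prod>i\<in>A. x i) = (\<Prod>i\<in>A \<union> B. if i \<in> A then x i else 1)"
       "(\<Prod>i\<in>B. x i) = (\<Prod>i\<in>A \<union> B. if i \<in> B then x i else 1)"
    using assms by (auto intro!: prod.mono_neutral_cong_left)
  then have "(\<Prod>i\<in>A. x i) * (\<Prod>i\<in>B. x i)
      = (\<Prod>i\<in>A \<union> B. (if i \<in> A then x i else 1) * (if i \<in> B then x i else 1))"
    by (simp add: prod.distrib)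
  also have "\<dots> = (\<Prod>i\<in>A \<union> B. if i \<in> A \<inter> B then (x i)\<^sup>2 else x i)"
    by (rule prod.cong) (auto simp: power2_eq_square)
  finally show ?thesis .
qed

text \<open>If \<open>A\<close> and \<open>B\<close> differ, some index lies in exactly one of them;
  by independence its centred factor splits off and annihilates the expectation. If they agree, only
  second moments remain.\<close>

lemma (in prob_space) orthogonal_products:
  fixes X :: "'i \<Rightarrow> 'a \<Rightarrow> real"
  assumes "finite I" and ind: "indep_vars (\<lambda>_. borel) X I"
    and int: "\<And>i. i \<in> I \<Longrightarrow> integrable M (X i)"
    and int2: "\<And>i. i \<in> I \<Longrightarrow> integrable M (\<lambda>x. (X i x)\<^sup>2)"
    and mean: "\<And>i. i \<in> I \<Longrightarrow> expectation (X i) = 0"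
    and var: "\<And>i. i \<in> I \<Longrightarrow> expectation (\<lambda>x. (X i x)\<^sup>2) = s"
    and sub: "A \<subseteq> I" "B \<subseteq> I"
  shows "integrable M (\<lambda>x. (\<Prod>i\<in>A. X i x) * (\<Prod>i\<in>B. X i x))"
    and "expectation (\<lambda>x. (\<Prod>i\<in>A. X i x) * (\<Prod>i\<in>B. X i x)) = (if A = B then s ^ card A else 0)"
proof -
  have fin: "finite A" "finite B" using sub assms(1) finite_subset by auto
  define f where "f i y = (if i \<in> A \<inter> B then y\<^sup>2 else y)" for i and y :: real
  have eq: "(\<lambda>x. (\<Prod>i\<in>A. X i x) * (\<Prod>i\<in>B. X i x)) = (\<lambda>x. \<Prod>i\<in>A \<union> B. f i (X i x))"
    using prod_mult_prod_Un[OF fin] by (simp add: f_def)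
  have ind': "indep_vars (\<lambda>_. borel) X (A \<union> B)"
    by (rule indep_vars_subset[OF ind]) (use sub in auto)
  have f: "f i \<in> borel_measurable borel" for i
    unfolding f_def by (cases "i \<in> A \<inter> B") simp_all
  have fint: "integrable M (\<lambda>x. f i (X i x))" if "i \<in> A \<union> B" for i
    using that sub int int2 by (cases "i \<in> A \<inter> B") (auto simp: f_def)
  have fE: "expectation (\<lambda>x. f i (X i x)) = (if i \<in> A \<inter> B then s else 0)" if "i \<in> A \<union> B" for i
    using that sub mean var by (cases "i \<in> A \<inter> B") (auto simp: f_def)
  note P = indep_vars_prod_expectation[OF _ ind' f fint]
  show "integrable M (\<lambda>x. (\<Prod>i\<in>A. X i x) * (\<Prod>i\<in>B. X i x))"
    unfolding eq using P(1) fin by auto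
  have "expectation (\<lambda>x. (\<Prod>i\<in>A. X i x) * (\<Prod>i\<in>B. X i x)) = (\<Prod>i\<in>A \<union> B. if i \<in> A \<inter> B then s else 0)"
    unfolding eq using P(2) fin fE by auto
  also have "\<dots> = (if A = B then s ^ card A else 0)"
  proof (cases "A = B")
    case False
    then have "\<exists>i\<in>A \<union> B. i \<notin> A \<inter> B" by auto
    then show ?thesis using False fin by (auto intro!: prod_zero)
  qed simp
  finally show "expectation (\<lambda>x. (\<Prod>i\<in>A. X i x) * (\<Prod>i\<in>B. X i x)) = (if A = B then s ^ card A else 0)" .
qed

text \<open>Orthogonality leaves only the diagonal of the double sum, as in Parseval's identity.
  Applied to a difference of coefficients, this gives the mean-square cost of replacing joint
  inclusion probabilities by powers of \<open>p\<close>.\<close>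

lemma (in prob_space) expectation_square_multilinear:
  fixes X :: "'i \<Rightarrow> 'a \<Rightarrow> real" and c :: "'i set \<Rightarrow> real"
  assumes "finite I" and ind: "indep_vars (\<lambda>_. borel) X I"
    and int: "\<And>i. i \<in> I \<Longrightarrow> integrable M (X i)"
    and int2: "\<And>i. i \<in> I \<Longrightarrow> integrable M (\<lambda>x. (X i x)\<^sup>2)"
    and mean: "\<And>i. i \<in> I \<Longrightarrow> expectation (X i) = 0"
    and var: "\<And>i. i \<in> I \<Longrightarrow> expectation (\<lambda>x. (X i x)\<^sup>2) = s"
  shows "integrable M (\<lambda>x. (\<Sum>A\<in>Pow I. c A * (\<Prod>i\<in>A. X i x))\<^sup>2)"
    and "expectation (\<lambda>x. (\<Sum>A\<in>Pow I. c A * (\<Prod>i\<in>A. X i x))\<^sup>2)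
           = (\<Sum>A\<in>Pow I. (c A)\<^sup>2 * s ^ card A)"
proof -
  have eq: "(\<lambda>x. (\<Sum>A\<in>Pow I. c A * (\<Prod>i\<in>A. X i x))\<^sup>2)
      = (\<lambda>x. \<Sum>A\<in>Pow I. \<Sum>B\<in>Pow I. (c A * c B) * ((\<Prod>i\<in>A. X i x) * (\<Prod>i\<in>B. X i x)))"
    by (simp add: power2_eq_square sum_product ac_simps)
  note P = orthogonal_products[OF assms]
  have I: "integrable M (\<lambda>x. (c A * c B) * ((\<Prod>i\<in>A. X i x) * (\<Prod>i\<in>B. X i x)))"
    if "A \<in> Pow I" "B \<in> Pow I" for A B
    using P(1) that by (intro integrable_mult_right) auto
  show "integrable M (\<lambda>x. (\<Sum>A\<in>Pow I. c A * (\<Prod>i\<in>A. X i x))\<^sup>2)"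
    unfolding eq by (rule Bochner_Integration.integrable_sum)+ (rule I)
  have "expectation (\<lambda>x. (\<Sum>A\<in>Pow I. c A * (\<Prod>i\<in>A. X i x))\<^sup>2)
      = (\<Sum>A\<in>Pow I. \<Sum>B\<in>Pow I.
          expectation (\<lambda>x. (c A * c B) * ((\<Prod>i\<in>A. X i x) * (\<Prod>i\<in>B. X i x))))"
    unfolding eq
    by (subst Bochner_Integration.integral_sum, intro Bochner_Integration.integrable_sum I, assumption+,
        intro sum.cong refl Bochner_Integration.integral_sum I, assumption+)
  also have "\<dots> = (\<Sum>A\<in>Pow I. \<Sum>B\<in>Pow I. c A * c B * (if A = B then s ^ card A else 0))"
    using P(2) by (intro sum.cong refl) auto
  also have "\<dots> = (\<Sum>A\<in>Pow I. (c A)\<^sup>2 * s ^ card A)"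
    using \<open>finite I\<close> by (simp add: power2_eq_square if_distrib[of "\<lambda>t. _ * t"] sum.delta' cong: if_cong)
  finally show "expectation (\<lambda>x. (\<Sum>A\<in>Pow I. c A * (\<Prod>i\<in>A. X i x))\<^sup>2)
           = (\<Sum>A\<in>Pow I. (c A)\<^sup>2 * s ^ card A)" .
qed

section \<open>Counting matchings and non-matchings\<close>

lemma sum_Pow_power_card:
  fixes x :: "'a :: comm_semiring_1"
  assumes "finite E"
  shows "(\<Sum>A\<in>Pow E. x ^ card A) = (1 + x) ^ card E"
  using prod_add[OF assms, of "\<lambda>_. x" "\<lambda>_. 1"] by (simp add: add.commute)

text \<open>Deleting \<open>e\<close> and \<open>f\<close> is a bijection onto the subsets of
  \<open>E - {e, f}\<close> and lowers the cardinality by two. The factor \<open>x\<^sup>2\<close>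
  that comes out is the gain from prescribing two edges.\<close>

lemma sum_Pow_power_card_containing_le:
  fixes x :: real
  assumes "finite E" "e \<in> E" "f \<in> E" "e \<noteq> f" "x \<ge> 0"
  shows "(\<Sum>A | A \<subseteq> E \<and> e \<in> A \<and> f \<in> A. x ^ card A) \<le> x\<^sup>2 * (1 + x) ^ card E"
proof -
  let ?F = "E - {e, f}"
  have card: "card (insert e (insert f B)) = card B + 2" if "B \<subseteq> ?F" for B
  proof -
    have "finite B" "e \<notin> B" "f \<notin> B" using that assms(1) finite_subset[of B E] by auto
    then show ?thesis using assms(4) by simp
  qed
  have img: "{A. A \<subseteq> E \<and> e \<in> A \<and> f \<in> A} = (\<lambda>B. insert e (insert f B)) ` Pow ?F"
  proof (intro equalityI subsetI)
    fix A assume A: "A \<in> {A. A \<subseteq> E \<and> e \<in> A \<and> f \<in> A}"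
    then have "A = insert e (insert f (A - {e, f}))" "A - {e, f} \<in> Pow ?F" by auto
    then show "A \<in> (\<lambda>B. insert e (insert f B)) ` Pow ?F" by (rule image_eqI)
  qed (use assms in auto)
  have inj: "inj_on (\<lambda>B. insert e (insert f B)) (Pow ?F)"
    by (rule inj_on_inverseI[where g="\<lambda>A. A - {e, f}"]) auto
  have "(\<Sum>A | A \<subseteq> E \<and> e \<in> A \<and> f \<in> A. x ^ card A) = (\<Sum>B\<in>Pow ?F. x ^ (card B + 2))"
    unfolding img by (subst sum.reindex[OF inj]) (use card in \<open>auto intro!: sum.cong\<close>)
  also have "\<dots> = x\<^sup>2 * (1 + x) ^ card ?F"
    using assms(1) by (simp only: power_add sum_Pow_power_card finite_Diff flip: sum_distrib_right)
      (simp only: mult.commute)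
  also have "\<dots> \<le> x\<^sup>2 * (1 + x) ^ card E"
    using assms by (intro mult_left_mono power_increasing card_mono) auto
  finally show ?thesis .
qed

text \<open>Such a pair is determined by its first edge, a shared endpoint (two choices) and the
  other endpoint of the second edge (at most \<open>card V\<close> choices); \<open>?T\<close>
  encodes these data.\<close>

lemma card_intersecting_edges_le:
  assumes "finite_graph V E"
  shows "card {(e, f). e \<in> E \<and> f \<in> E \<and> e \<noteq> f \<and> \<not> disjnt e f} \<le> 2 * card V * card E"
proof -
  have fV: "finite V" and E: "\<And>e. e \<in> E \<Longrightarrow> e \<subseteq> V \<and> card e = 2"
    using assms by (auto simp: finite_graph_def)
  have fE: "finite E" by (rule finite_subset[of _ "Pow V"]) (use E fV in auto)
  have fe: "finite e" if "e \<in> E" for e using E that fV finite_subset by blast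
  let ?T = "SIGMA e:E. e \<times> V"
  have "{(e, f). e \<in> E \<and> f \<in> E \<and> e \<noteq> f \<and> \<not> disjnt e f} \<subseteq> (\<lambda>(e, u, v). (e, {u, v})) ` ?T"
  proof clarify
    fix e f assume ef: "e \<in> E" "f \<in> E" "\<not> disjnt e f"
    then obtain u where u: "u \<in> e" "u \<in> f" by (auto simp: disjnt_def)
    obtain v where "f = {u, v}" using E[OF ef(2)] u(2) by (auto simp: card_2_iff)
    then have "(e, f) = (\<lambda>(e, u, v). (e, {u, v})) (e, u, v)" "(e, u, v) \<in> ?T"
      using ef u E[OF ef(2)] by auto
    then show "(e, f) \<in> (\<lambda>(e, u, v). (e, {u, v})) ` ?T" by (rule image_eqI)
  qed
  then have "card {(e, f). e \<in> E \<and> f \<in> E \<and> e \<noteq> f \<and> \<not> disjnt e f} \<le> card ?T"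
    using fE fe fV by (intro surj_card_le finite_SigmaI finite_cartesian_product) auto
  also have "\<dots> = (\<Sum>e\<in>E. card (e \<times> V))"
    using fE fe fV by (intro card_SigmaI) auto
  also have "\<dots> = 2 * card V * card E"
    using E by (simp add: card_cartesian_product)
  finally show ?thesis .
qed

text \<open>A set of edges that is not a matching contains two distinct edges that meet, so a union
  bound over the meeting pairs applies.\<close>

lemma sum_nonmatching_power_card_le:
  fixes x :: real
  assumes G: "finite_graph V E" and "finite E" and x: "x \<ge> 0"
  shows "(\<Sum>A | A \<subseteq> E \<and> \<not> pairwise disjnt A. x ^ card A)
           \<le> 2 * real (card V) * real (card E) * (x\<^sup>2 * (1 + x) ^ card E)"
proof -
  let ?P = "{(e, f). e \<in> E \<and> f \<in> E \<and> e \<noteq> f \<and> \<not> disjnt e f}"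
  have fP: "finite ?P" by (rule finite_subset[of _ "E \<times> E"]) (use assms in auto)
  let ?C = "\<lambda>q. {A. A \<subseteq> E \<and> fst q \<in> A \<and> snd q \<in> A}"
  have "(\<Sum>A | A \<subseteq> E \<and> \<not> pairwise disjnt A. x ^ card A)
      \<le> (\<Sum>A | A \<subseteq> E \<and> \<not> pairwise disjnt A. \<Sum>q\<in>?P. if A \<in> ?C q then x ^ card A else 0)"
  proof (rule sum_mono)
    fix A assume A: "A \<in> {A. A \<subseteq> E \<and> \<not> pairwise disjnt A}"
    then obtain q where q: "q \<in> ?P" "A \<in> ?C q" by (fastforce simp: pairwise_def)
    then have "(if A \<in> ?C q then x ^ card A else 0) \<le> (\<Sum>q\<in>?P. if A \<in> ?C q then x ^ card A else 0)"
      using fP x by (intro member_le_sum) auto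
    with q show "x ^ card A \<le> (\<Sum>q\<in>?P. if A \<in> ?C q then x ^ card A else 0)" by simp
  qed
  also have "\<dots> \<le> (\<Sum>A\<in>Pow E. \<Sum>q\<in>?P. if A \<in> ?C q then x ^ card A else 0)"
    using assms x by (intro sum_mono2 sum_nonneg) auto
  also have "\<dots> = (\<Sum>q\<in>?P. \<Sum>A\<in>Pow E. if A \<in> ?C q then x ^ card A else 0)"
    by (rule sum.swap)
  also have "\<dots> = (\<Sum>q\<in>?P. \<Sum>A\<in>?C q. x ^ card A)"
    using assms(2) by (intro sum.cong[OF refl] sum.mono_neutral_cong_right) auto
  also have "\<dots> \<le> (\<Sum>q\<in>?P. x\<^sup>2 * (1 + x) ^ card E)"
    by (intro sum_mono sum_Pow_power_card_containing_le) (use assms in auto)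
  also have "\<dots> = real (card ?P) * (x\<^sup>2 * (1 + x) ^ card E)" by simp
  also have "\<dots> \<le> real (2 * card V * card E) * (x\<^sup>2 * (1 + x) ^ card E)"
    using card_intersecting_edges_le[OF G] x
    by (intro mult_right_mono) (auto simp del: of_nat_mult)
  finally show ?thesis by simp
qed

text \<open>Matchings are many, but their error \<open>1 / sqrt m\<close> squares to
  \<open>1 / m\<close>; non-matchings have no small factor but are rare. In the application
  \<open>x * card E\<close> stays bounded, so the exponential is harmless and the second term is of
  order \<open>card V / card E\<close>.\<close>

lemma sum_square_deviation_le:
  fixes a :: "'v set set \<Rightarrow> real" and p s \<rho> m :: real
  assumes G: "finite_graph V E" and "finite E" and "m > 0" "s \<ge> 0" "p \<ge> 0"
    and matching: "\<And>A. A \<subseteq> E \<Longrightarrow> pairwise disjnt A \<Longrightarrow> \<bar>a A - p ^ card A\<bar> \<le> (\<rho> * p) ^ card A / sqrt m"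
    and nonmatching: "\<And>A. A \<subseteq> E \<Longrightarrow> \<not> pairwise disjnt A \<Longrightarrow> \<bar>a A - p ^ card A\<bar> \<le> (\<rho> * p) ^ card A"
  defines "x \<equiv> (\<rho> * p)\<^sup>2 * s"
  shows "(\<Sum>A\<in>Pow E. (a A - p ^ card A)\<^sup>2 * s ^ card A)
    \<le> (1 / m + 2 * real (card V) * real (card E) * x\<^sup>2) * exp (x * real (card E))"
proof -
  let ?g = "\<lambda>A. (a A - p ^ card A)\<^sup>2 * s ^ card A"
  have x: "x \<ge> 0" using assms by simp
  have E: "(1 + x) ^ card E \<le> exp (x * real (card E))"
    using power_mono[OF exp_ge_add_one_self, of x "card E"] x
    by (simp add: exp_of_nat_mult ac_simps flip: exp_of_nat_mult)
  have pow: "((\<rho> * p) ^ k)\<^sup>2 * s ^ k = x ^ k" for k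
    by (simp add: x_def power_mult_distrib power_commutes flip: power_mult) (simp add: mult.commute)
  have 1: "?g A \<le> x ^ card A / m" if "A \<subseteq> E" "pairwise disjnt A" for A
  proof -
    have "\<bar>a A - p ^ card A\<bar>\<^sup>2 \<le> ((\<rho> * p) ^ card A / sqrt m)\<^sup>2"
      using matching[OF that] by (intro power_mono) auto
    then have "?g A \<le> ((\<rho> * p) ^ card A / sqrt m)\<^sup>2 * s ^ card A"
      using \<open>s \<ge> 0\<close> by (intro mult_right_mono) auto
    then show ?thesis using \<open>m > 0\<close> pow by (simp add: power_divide)
  qed
  have 2: "?g A \<le> x ^ card A" if "A \<subseteq> E" "\<not> pairwise disjnt A" for A
  proof -
    have "\<bar>a A - p ^ card A\<bar>\<^sup>2 \<le> ((\<rho> * p) ^ card A)\<^sup>2"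
      using nonmatching[OF that] by (intro power_mono) auto
    then have "?g A \<le> ((\<rho> * p) ^ card A)\<^sup>2 * s ^ card A"
      using \<open>s \<ge> 0\<close> by (intro mult_right_mono) auto
    then show ?thesis using pow by simp
  qed
  have "sum ?g (Pow E) = sum ?g {A. A \<subseteq> E \<and> pairwise disjnt A} + sum ?g {A. A \<subseteq> E \<and> \<not> pairwise disjnt A}"
    using assms(2) by (subst sum.union_disjoint[symmetric]) (auto intro!: sum.cong)
  also have "sum ?g {A. A \<subseteq> E \<and> pairwise disjnt A} \<le> (\<Sum>A | A \<subseteq> E \<and> pairwise disjnt A. x ^ card A / m)"
    using 1 by (intro sum_mono) auto
  also have "\<dots> \<le> (\<Sum>A\<in>Pow E. x ^ card A / m)"
    using assms x by (intro sum_mono2) auto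
  also have "\<dots> = (1 / m) * (1 + x) ^ card E"
    using assms by (simp add: sum_Pow_power_card flip: sum_divide_distrib)
  also have "\<dots> \<le> (1 / m) * exp (x * real (card E))"
    using assms E by (intro mult_left_mono) auto
  also have "sum ?g {A. A \<subseteq> E \<and> \<not> pairwise disjnt A} \<le> (\<Sum>A | A \<subseteq> E \<and> \<not> pairwise disjnt A. x ^ card A)"
    using 2 by (intro sum_mono) auto
  also have "\<dots> \<le> 2 * real (card V) * real (card E) * (x\<^sup>2 * (1 + x) ^ card E)"
    by (rule sum_nonmatching_power_card_le[OF G assms(2) x])
  also have "\<dots> \<le> 2 * real (card V) * real (card E) * (x\<^sup>2 * exp (x * real (card E)))"
    using E by (intro mult_left_mono) auto
  finally show ?thesis by (simp add: algebra_simps)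
qed

text \<open>Serves to bound the product of the factors \<open>1 + p * X i\<close> below by the
  exponential of a linear and a quadratic statistic. The threshold \<open>- 1 / 2\<close> is what
  \<open>X i \<ge> - 1\<close> and \<open>p \<le> 1 / 2\<close> guarantee.\<close>

lemma exp_le_one_plus:
  fixes x :: real
  assumes "x \<ge> - 1 / 2"
  shows "exp (x - 2 * x\<^sup>2) \<le> 1 + x"
proof -
  have pos: "1 + x > 0" using assms by simp
  have "x - 2 * x\<^sup>2 \<le> ln (1 + x)"
  proof (cases "x \<ge> 0")
    case False
    then show ?thesis using ln_one_minus_pos_lower_bound[of "- x"] assms by simp
  next
    case True
    show ?thesis
    proof (cases "x \<le> 1")
      case True
      with \<open>x \<ge> 0\<close> show ?thesis using ln_one_plus_pos_lower_bound[of x] by (smt (verit) zero_le_power2)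
    next
      case False
      \<comment> \<open>Beyond 1 the quadratic term makes the left side negative, while the
        logarithm is nonnegative.\<close>
      then have "x * 1 \<le> x * x" by (intro mult_left_mono) auto
      moreover have "ln (1 + x) \<ge> 0" using True by simp
      ultimately show ?thesis using False unfolding power2_eq_square by linarith
    qed
  qed
  then have "exp (x - 2 * x\<^sup>2) \<le> exp (ln (1 + x))" by simp
  then show ?thesis using pos by simp
qed

section \<open>The Gibbs measure and its normalisation\<close>

lemma boltzmann_nonneg: "boltzmann b x \<ge> 0"
  by (simp add: boltzmann_def)

text \<open>Multiplicativity extends to infinite weights, even for \<open>b = 0\<close>, because the
  value at \<infinity> is 0 for every \<open>b\<close>. At -\<infinity> it can fail, since
  \<open>real_of_ereal\<close> returns 0 there.\<close>

lemma boltzmann_add: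
  assumes "x \<noteq> -\<infinity>" "y \<noteq> -\<infinity>"
  shows "boltzmann b (x + y) = boltzmann b x * boltzmann b y"
  using assms by (cases x; cases y) (auto simp: boltzmann_def algebra_simps simp flip: exp_add)

lemma sum_not_MInfty:
  fixes w :: "'a \<Rightarrow> ereal"
  assumes "\<And>e. e \<in> A \<Longrightarrow> w e \<noteq> -\<infinity>"
  shows "(\<Sum>e\<in>A. w e) \<noteq> -\<infinity>"
  using assms by (induction A rule: infinite_finite_induct) (auto simp: ereal_plus_eq_MInfty)

lemma boltzmann_total_weight:
  assumes "finite A" "\<And>e. e \<in> A \<Longrightarrow> w e \<noteq> -\<infinity>"
  shows "boltzmann b (total_weight w A) = (\<Prod>e\<in>A. boltzmann b (w e))"
  using assms
proof (induction A rule: finite_induct)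
  case (insert e A)
  then show ?case
    by (simp add: total_weight_def boltzmann_add sum_not_MInfty)
qed (simp add: total_weight_def boltzmann_def)

lemma measure_gibbs_measure:
  assumes "finite S" "A \<subseteq> S"
  shows "measure (gibbs_measure S b w) A = (\<Sum>\<pi>\<in>A. gibbs_mass S b w \<pi>)"
proof -
  have nn: "gibbs_mass S b w \<pi> \<ge> 0" for \<pi>
    by (auto simp: gibbs_mass_def partition_function_def boltzmann_nonneg
        intro!: divide_nonneg_nonneg mult_nonneg_nonneg sum_nonneg)
  have "emeasure (gibbs_measure S b w) A = ennreal (\<Sum>\<pi>\<in>A. gibbs_mass S b w \<pi>)"
    unfolding gibbs_measure_def using assms nn by (simp add: emeasure_point_measure_finite sum_ennreal)
  then show ?thesis using nn by (simp add: measure_def sum_nonneg)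
qed

lemma uniform_prob_eq:
  assumes "finite S" "S \<noteq> {}"
  shows "uniform_prob S {\<pi>. P \<pi>} = real (card {\<pi>\<in>S. P \<pi>}) / real (card S)"
  using assms by (simp add: uniform_prob_def measure_pmf_of_set Int_def)

text \<open>Expand each product over the subsets of \<pi> and exchange the sums: each
  \<open>A\<close> is then counted once for every configuration containing it. With centred
  \<open>z\<close> this is the orthogonal expansion of the normalised partition function.\<close>

lemma average_prod_eq_sum_uniform_prob:
  fixes z :: "'e \<Rightarrow> real"
  assumes "finite E" "S \<subseteq> Pow E" "S \<noteq> {}"
  shows "(\<Sum>\<pi>\<in>S. \<Prod>e\<in>\<pi>. 1 + z e) / real (card S)
       = (\<Sum>A\<in>Pow E. uniform_prob S {\<pi>. A \<subseteq> \<pi>} * (\<Prod>e\<in>A. z e))"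
proof -
  have fS: "finite S" using assms finite_subset by auto
  have fin: "finite \<pi>" if "\<pi> \<in> S" for \<pi> using assms that finite_subset by blast
  have "(\<Sum>\<pi>\<in>S. \<Prod>e\<in>\<pi>. 1 + z e) = (\<Sum>\<pi>\<in>S. \<Sum>A\<in>Pow E. if A \<subseteq> \<pi> then \<Prod>e\<in>A. z e else 0)"
  proof (rule sum.cong[OF refl])
    fix \<pi> assume \<pi>: "\<pi> \<in> S"
    have "(\<Prod>e\<in>\<pi>. 1 + z e) = (\<Sum>A\<in>Pow \<pi>. \<Prod>e\<in>A. z e)"
      using prod_add[OF fin[OF \<pi>], of z "\<lambda>_. 1"] by (simp add: add.commute)
    also have "\<dots> = (\<Sum>A\<in>{A\<in>Pow E. A \<subseteq> \<pi>}. \<Prod>e\<in>A. z e)"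
      by (rule sum.cong) (use \<pi> assms in auto)
    also have "\<dots> = (\<Sum>A\<in>Pow E. if A \<subseteq> \<pi> then \<Prod>e\<in>A. z e else 0)"
      by (rule sum.inter_filter) (use assms in auto)
    finally show "(\<Prod>e\<in>\<pi>. 1 + z e) = (\<Sum>A\<in>Pow E. if A \<subseteq> \<pi> then \<Prod>e\<in>A. z e else 0)" .
  qed
  also have "\<dots> = (\<Sum>A\<in>Pow E. \<Sum>\<pi>\<in>S. if A \<subseteq> \<pi> then \<Prod>e\<in>A. z e else 0)"
    by (rule sum.swap)
  also have "\<dots> = (\<Sum>A\<in>Pow E. real (card {\<pi>\<in>S. A \<subseteq> \<pi>}) * (\<Prod>e\<in>A. z e))"
    using fS by (intro sum.cong refl, subst sum.inter_filter[symmetric]) auto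
  finally show ?thesis
    using fS assms by (simp add: uniform_prob_eq sum_divide_distrib)
qed

text \<open>
  In terms of \<open>X\<close>, the summand \<open>q 2 \<pi> - 2 * q 1 \<pi> + q 0 \<pi>\<close> is the Boltzmann factor of \<open>\<pi>\<close> times
  \<open>(exp (- X) - 1)\<^sup>2\<close>. Stated through products over edges it has an explicit expectation, and no
  measurability of \<open>total_weight\<close> is needed.
\<close>
lemma gibbs_tail_le:
  fixes w :: "'e \<Rightarrow> ereal" and \<beta> D \<epsilon> lam :: real and m :: nat
  assumes "finite E" "S \<subseteq> Pow E" "S \<noteq> {}" and card: "\<And>\<pi>. \<pi> \<in> S \<Longrightarrow> card \<pi> = m"
    and "m > 0" "lam > 0" "\<epsilon> > 0"
    and w: "\<And>e. e \<in> E \<Longrightarrow> w e \<noteq> -\<infinity>"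
  defines "N \<equiv> (\<Sum>\<pi>\<in>S. \<Prod>e\<in>\<pi>. boltzmann \<beta> (w e) / lam) / real (card S)"
    and "q \<equiv> (\<lambda>j \<pi>. \<Prod>e\<in>\<pi>. boltzmann (\<beta> + j / real m) (w e) * (exp (- j * D / real m) / lam))"
  defines "H \<equiv> (\<Sum>\<pi>\<in>S. q 2 \<pi> - 2 * q 1 \<pi> + q 0 \<pi>) / real (card S)"
  shows "N > 0 \<Longrightarrow> (1 - exp (- \<epsilon>))\<^sup>2 * measure (gibbs_measure S \<beta> w)
          {\<pi> \<in> S. \<bar>total_weight w \<pi> / ereal (real m) + ereal D\<bar> > ereal \<epsilon>} * N \<le> H"
    and "H \<ge> 0"
proof -
  let ?k = "(1 - exp (- \<epsilon>))\<^sup>2"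
  let ?B = "\<lambda>\<pi>. boltzmann \<beta> (total_weight w \<pi>)"
  let ?h = "\<lambda>\<pi>. q 2 \<pi> - 2 * q 1 \<pi> + q 0 \<pi>"
  define A where "A = {\<pi> \<in> S. \<bar>total_weight w \<pi> / ereal (real m) + ereal D\<bar> > ereal \<epsilon>}"
  have fS: "finite S" by (rule finite_subset[OF assms(2)]) (use assms(1) in simp)
  have cS: "real (card S) > 0" using fS assms(3) by (simp add: card_gt_0_iff)
  have fin: "finite \<pi>" if "\<pi> \<in> S" for \<pi>
    using assms(1,2) that finite_subset by blast
  have w': "w e \<noteq> -\<infinity>" if "\<pi> \<in> S" "e \<in> \<pi>" for \<pi> e using w that assms(2) by blast
  have bt: "(\<Prod>e\<in>\<pi>. boltzmann b (w e)) = boltzmann b (total_weight w \<pi>)" if "\<pi> \<in> S" for b \<pi>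
    using boltzmann_total_weight[OF fin[OF that], of w b] w'[OF that] by simp
  have q: "q j \<pi> = boltzmann (\<beta> + j / real m) (total_weight w \<pi>) * exp (- j * D) / lam ^ m"
    if "\<pi> \<in> S" for j \<pi>
  proof -
    have "exp (- j * D / real m) ^ m = exp (- j * D)"
      using \<open>m > 0\<close> by (simp flip: exp_of_nat_mult)
    then show ?thesis
      using that card[OF that] by (simp add: q_def prod.distrib prod_dividef bt power_divide)
  qed
  have h: "?h \<pi> \<ge> (if \<pi> \<in> A then ?k * (?B \<pi> / lam ^ m) else 0)" if \<pi>: "\<pi> \<in> S" for \<pi>
  proof -
    have "total_weight w \<pi> \<noteq> -\<infinity>"
      unfolding total_weight_def by (rule sum_not_MInfty) (use w'[OF \<pi>] in auto)
    then consider R where "total_weight w \<pi> = ereal R" | "total_weight w \<pi> = \<infinity>"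
      by (cases "total_weight w \<pi>") auto
    then show ?thesis
    proof cases
      \<comment> \<open>An infinite total weight has Boltzmann factor 0 at every inverse
        temperature, so both sides vanish even if \<pi> lies in \<open>A\<close>.\<close>
      case 2
      then show ?thesis using \<pi> by (simp add: q boltzmann_def)
    next
      case 1
      define x where "x = R / real m + D"
      have Bp: "?B \<pi> / lam ^ m \<ge> 0" using assms by (simp add: boltzmann_nonneg)
      have qx: "q j \<pi> = ?B \<pi> / lam ^ m * exp (- j * x)" for j
        by (simp add: q[OF \<pi>] 1 boltzmann_def x_def algebra_simps flip: exp_add)
      have "exp (- 2 * x) = exp (- x) * exp (- x)" by (simp flip: exp_add)
      then have hx: "?h \<pi> = (?B \<pi> / lam ^ m) * (1 - exp (- x))\<^sup>2"
        unfolding qx by (simp add: power2_eq_square algebra_simps add_divide_distrib)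
      have "?k \<le> (1 - exp (- x))\<^sup>2" if "\<pi> \<in> A"
      proof -
        have "\<bar>x\<bar> > \<epsilon>" using that 1 \<open>m > 0\<close> by (simp add: A_def x_def)
        then consider "x > \<epsilon>" | "x < - \<epsilon>" by linarith
        then have "\<bar>1 - exp (- \<epsilon>)\<bar> \<le> \<bar>1 - exp (- x)\<bar>"
        proof cases
          case 1
          then have "exp (- x) \<le> exp (- \<epsilon>)" "exp (- \<epsilon>) \<le> 1" using \<open>\<epsilon> > 0\<close> by auto
          then show ?thesis by simp
        next
          case 2
          \<comment> \<open>For negative \<open>x\<close> the claim reduces to
            \<open>exp \<epsilon> - 1 \<ge> 1 - exp (- \<epsilon>)\<close>, which follows from
            \<open>(exp \<epsilon> - 1)\<^sup>2 \<ge> 0\<close> after multiplication by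
            \<open>exp \<epsilon>\<close>.\<close>
          have "exp (- \<epsilon>) * exp \<epsilon> = 1" by (simp flip: exp_add)
          moreover have "(exp \<epsilon> - 1)\<^sup>2 \<ge> 0" by simp
          ultimately have "(exp \<epsilon> + exp (- \<epsilon>) - 2) * exp \<epsilon> \<ge> 0"
            by (simp add: power2_eq_square algebra_simps)
          then have "exp \<epsilon> + exp (- \<epsilon>) \<ge> 2"
            by (simp add: zero_le_mult_iff)
          moreover have "exp \<epsilon> \<le> exp (- x)" "exp (- \<epsilon>) \<le> 1" using 2 \<open>\<epsilon> > 0\<close> by auto
          ultimately show ?thesis by linarith
        qed
        then show ?thesis by (simp add: abs_le_square_iff)
      qed
      then have "\<pi> \<in> A \<Longrightarrow> (?B \<pi> / lam ^ m) * ?k \<le> (?B \<pi> / lam ^ m) * (1 - exp (- x))\<^sup>2"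
        by (intro mult_left_mono Bp)
      moreover have "(?B \<pi> / lam ^ m) * (1 - exp (- x))\<^sup>2 \<ge> 0"
        by (rule mult_nonneg_nonneg[OF Bp]) simp
      ultimately show ?thesis unfolding hx by (simp only: mult.commute[of ?k] split: if_split) blast
    qed
  qed
  \<comment> \<open>All configurations have \<open>m\<close> edges, so normalising every edge factor
    by \<open>lam\<close> costs one global constant, which cancels in the Gibbs mass.\<close>
  have Z: "partition_function S \<beta> w = lam ^ m * N"
  proof -
    have "(\<Prod>e\<in>\<pi>. boltzmann \<beta> (w e) / lam) = ?B \<pi> / lam ^ m" if "\<pi> \<in> S" for \<pi>
      using that card[OF that] by (simp add: prod_dividef bt)
    then show ?thesis
      using \<open>lam > 0\<close> by (simp add: partition_function_def N_def flip: sum_divide_distrib)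
  qed
  show "?k * measure (gibbs_measure S \<beta> w)
          {\<pi> \<in> S. \<bar>total_weight w \<pi> / ereal (real m) + ereal D\<bar> > ereal \<epsilon>} * N \<le> H" if N: "N > 0"
  proof -
    have "measure (gibbs_measure S \<beta> w) A = (\<Sum>\<pi>\<in>A. gibbs_mass S \<beta> w \<pi>)"
      by (rule measure_gibbs_measure[OF fS]) (auto simp: A_def)
    \<comment> \<open>Positivity of \<open>N\<close> excludes the uniform default in
      \<open>gibbs_mass\<close>.\<close>
    also have "\<dots> = (\<Sum>\<pi>\<in>A. ?B \<pi> / lam ^ m) / (N * real (card S))"
      using N \<open>lam > 0\<close> unfolding sum_divide_distrib
      by (intro sum.cong refl) (simp add: gibbs_mass_def Z field_simps)
    finally have "?k * measure (gibbs_measure S \<beta> w) A * N = (\<Sum>\<pi>\<in>A. ?k * (?B \<pi> / lam ^ m)) / real (card S)"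
      using N cS by (simp only: sum_distrib_left[symmetric]) (simp add: field_simps)
    also have "(\<Sum>\<pi>\<in>A. ?k * (?B \<pi> / lam ^ m)) = (\<Sum>\<pi>\<in>S. if \<pi> \<in> A then ?k * (?B \<pi> / lam ^ m) else 0)"
      using fS by (subst sum.inter_filter[symmetric]) (auto intro!: sum.cong simp: A_def)
    also have "\<dots> / real (card S) \<le> H"
      unfolding H_def using cS by (intro divide_right_mono sum_mono h) auto
    finally show "?k * measure (gibbs_measure S \<beta> w)
            {\<pi> \<in> S. \<bar>total_weight w \<pi> / ereal (real m) + ereal D\<bar> > ereal \<epsilon>} * N \<le> H"
      unfolding A_def .
  qed
  show "H \<ge> 0"
  proof -
    have "?h \<pi> \<ge> 0" if "\<pi> \<in> S" for \<pi>
    proof -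
      have "(if \<pi> \<in> A then ?k * (?B \<pi> / lam ^ m) else 0) \<ge> 0"
        using \<open>lam > 0\<close> by (simp add: boltzmann_nonneg)
      then show ?thesis using h[OF that] by linarith
    qed
    then show ?thesis unfolding H_def by (intro divide_nonneg_nonneg sum_nonneg) auto
  qed
qed

section \<open>Lower tail of the normalised partition function\<close>

lemma (in prob_space) expectation_square_sum:
  fixes X :: "'i \<Rightarrow> 'a \<Rightarrow> real"
  assumes "finite I" "indep_vars (\<lambda>_. borel) X I"
    and "\<And>i. i \<in> I \<Longrightarrow> integrable M (X i)"
    and "\<And>i. i \<in> I \<Longrightarrow> integrable M (\<lambda>x. (X i x)\<^sup>2)"
    and "\<And>i. i \<in> I \<Longrightarrow> expectation (X i) = 0"
    and "\<And>i. i \<in> I \<Longrightarrow> expectation (\<lambda>x. (X i x)\<^sup>2) = s"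
  shows "integrable M (\<lambda>x. (\<Sum>i\<in>I. X i x)\<^sup>2)"
    and "expectation (\<lambda>x. (\<Sum>i\<in>I. X i x)\<^sup>2) = real (card I) * s"
proof -
  have eq: "(\<lambda>x. (\<Sum>i\<in>I. X i x)\<^sup>2) = (\<lambda>x. \<Sum>i\<in>I. \<Sum>j\<in>I. X i x * X j x)"
    by (simp add: power2_eq_square sum_product)
  have P: "integrable M (\<lambda>x. X i x * X j x)"
    "expectation (\<lambda>x. X i x * X j x) = (if i = j then s else 0)" if "i \<in> I" "j \<in> I" for i j
    using orthogonal_products[OF assms, of "{i}" "{j}"] that by auto
  show "integrable M (\<lambda>x. (\<Sum>i\<in>I. X i x)\<^sup>2)"
    unfolding eq by (rule Bochner_Integration.integrable_sum)+ (rule P)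
  have "expectation (\<lambda>x. (\<Sum>i\<in>I. X i x)\<^sup>2) = (\<Sum>i\<in>I. \<Sum>j\<in>I. expectation (\<lambda>x. X i x * X j x))"
    unfolding eq
    by (subst Bochner_Integration.integral_sum, intro Bochner_Integration.integrable_sum P, assumption+,
        intro sum.cong refl Bochner_Integration.integral_sum P, assumption+)
  also have "\<dots> = real (card I) * s"
    using \<open>finite I\<close> by (simp add: P(2))
  finally show "expectation (\<lambda>x. (\<Sum>i\<in>I. X i x)\<^sup>2) = real (card I) * s" .
qed

text \<open>Three Markov bounds are added: for the squared linear statistic \<open>T\<close>, the
  quadratic statistic \<open>U\<close> and the squared discrepancy \<open>R\<close> between
  \<open>N\<close> and the product \<open>Y\<close>. Off these three events \<open>Y\<close> is
  bounded below and \<open>N\<close> is close to it.\<close>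

lemma (in prob_space) multilinear_lower_tail:
  fixes X :: "'i \<Rightarrow> 'a \<Rightarrow> real" and a :: "'i set \<Rightarrow> real"
  assumes "finite I" and ind: "indep_vars (\<lambda>_. borel) X I"
    and int: "\<And>i. i \<in> I \<Longrightarrow> integrable M (X i)"
    and int2: "\<And>i. i \<in> I \<Longrightarrow> integrable M (\<lambda>x. (X i x)\<^sup>2)"
    and mean: "\<And>i. i \<in> I \<Longrightarrow> expectation (X i) = 0"
    and var: "\<And>i. i \<in> I \<Longrightarrow> expectation (\<lambda>x. (X i x)\<^sup>2) = s"
    and X: "\<And>i x. i \<in> I \<Longrightarrow> X i x \<ge> - 1"
    and p: "0 \<le> p" "p \<le> 1 / 2" and "L > 0"
  shows "prob {x \<in> space M. (\<Sum>A\<in>Pow I. a A * (\<Prod>i\<in>A. X i x)) < exp (- 3 * L) / 2}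
    \<le> p\<^sup>2 * real (card I) * s * (1 / L\<^sup>2 + 1 / L)
       + 4 * exp (6 * L) * (\<Sum>A\<in>Pow I. (a A - p ^ card A)\<^sup>2 * s ^ card A)"
proof -
  define N where "N x = (\<Sum>A\<in>Pow I. a A * (\<Prod>i\<in>A. X i x))" for x
  define Y where "Y x = (\<Prod>i\<in>I. 1 + p * X i x)" for x
  define R where "R x = (\<Sum>A\<in>Pow I. (a A - p ^ card A) * (\<Prod>i\<in>A. X i x))\<^sup>2" for x
  define T where "T x = (p * (\<Sum>i\<in>I. X i x))\<^sup>2" for x
  define U where "U x = p\<^sup>2 * (\<Sum>i\<in>I. (X i x)\<^sup>2)" for x
  \<comment> \<open>Half of the lower bound for \<open>Y\<close>, so that a discrepancy below \<eta>
    still leaves \<open>N\<close> above \<eta>.\<close>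
  define \<eta> where "\<eta> = exp (- 3 * L) / 2"
  have intR: "integrable M R" and ER: "expectation R = (\<Sum>A\<in>Pow I. (a A - p ^ card A)\<^sup>2 * s ^ card A)"
    unfolding R_def using assms by (simp_all add: expectation_square_multilinear)
  have intT: "integrable M T" and ET: "expectation T = p\<^sup>2 * real (card I) * s"
    unfolding T_def power_mult_distrib using assms by (simp_all add: expectation_square_sum)
  have intU: "integrable M U" and EU: "expectation U = p\<^sup>2 * real (card I) * s"
    unfolding U_def using assms by (simp_all add: Bochner_Integration.integral_sum)
  have Y: "Y x = (\<Sum>A\<in>Pow I. p ^ card A * (\<Prod>i\<in>A. X i x))" for x
    unfolding Y_def using prod_add[OF assms(1), of "\<lambda>i. p * X i x" "\<lambda>_. 1"]
    by (simp add: add.commute prod.distrib)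
  have R: "R x = (N x - Y x)\<^sup>2" for x
    by (simp add: R_def N_def Y left_diff_distrib sum_subtractf)
  have Ylow: "Y x \<ge> exp (- 3 * L)" if "T x < L\<^sup>2" "U x < L" for x
  proof -
    have "\<bar>p * (\<Sum>i\<in>I. X i x)\<bar> < L"
      using that(1) \<open>L > 0\<close> unfolding T_def by (metis abs_le_square_iff abs_of_pos not_le)
    \<comment> \<open>The linear term costs at most \<open>L\<close> and twice the quadratic one at
      most \<open>2 * L\<close>.\<close>
    then have "- 3 * L \<le> p * (\<Sum>i\<in>I. X i x) - 2 * U x" using that(2) by linarith
    also have "\<dots> = (\<Sum>i\<in>I. p * X i x - 2 * (p * X i x)\<^sup>2)"
      by (simp add: U_def sum_subtractf sum_distrib_left power_mult_distrib ac_simps)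
    finally have "exp (- 3 * L) \<le> exp (\<Sum>i\<in>I. p * X i x - 2 * (p * X i x)\<^sup>2)" by simp
    also have "\<dots> = (\<Prod>i\<in>I. exp (p * X i x - 2 * (p * X i x)\<^sup>2))"
      using assms(1) by (rule exp_sum)
    also have "\<dots> \<le> Y x"
      unfolding Y_def
    proof (intro prod_mono conjI exp_le_one_plus)
      fix i assume "i \<in> I"
      then have "p * X i x \<ge> p * (- 1)" using X p by (intro mult_left_mono) auto
      then show "- 1 / 2 \<le> p * X i x" using p by simp
    qed simp
    finally show ?thesis .
  qed
  have sub: "{x \<in> space M. N x < \<eta>} \<subseteq>
     {x \<in> space M. T x \<ge> L\<^sup>2} \<union> {x \<in> space M. U x \<ge> L} \<union> {x \<in> space M. R x \<ge> \<eta>\<^sup>2}"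
  proof safe
    fix x assume x: "N x < \<eta>" "\<not> R x \<ge> \<eta>\<^sup>2" "\<not> U x \<ge> L"
    have "\<eta> > 0" by (simp add: \<eta>_def)
    then have "\<bar>N x - Y x\<bar> < \<eta>" using x(2) unfolding R by (metis abs_le_square_iff abs_of_pos not_le)
    then have "Y x < exp (- 3 * L)" using x(1) unfolding \<eta>_def by linarith
    then show "T x \<ge> L\<^sup>2" using Ylow[of x] x(3) by linarith
  qed
  have meas[measurable]: "R \<in> borel_measurable M" "T \<in> borel_measurable M" "U \<in> borel_measurable M"
    using intR intT intU by auto
  have "prob {x \<in> space M. N x < \<eta>} \<le>
     prob ({x \<in> space M. T x \<ge> L\<^sup>2} \<union> {x \<in> space M. U x \<ge> L} \<union> {x \<in> space M. R x \<ge> \<eta>\<^sup>2})"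
    by (rule finite_measure_mono[OF sub]) measurable
  also have "\<dots> \<le> prob {x \<in> space M. T x \<ge> L\<^sup>2} + prob {x \<in> space M. U x \<ge> L} + prob {x \<in> space M. R x \<ge> \<eta>\<^sup>2}"
    by (intro order_trans[OF measure_Un_le] add_mono order_refl) measurable
  also have "\<dots> \<le> expectation T / L\<^sup>2 + expectation U / L + expectation R / \<eta>\<^sup>2"
    using \<open>L > 0\<close>
    by (intro add_mono integral_Markov_inequality_measure[where A="space M"] intR intT intU)
       (auto simp: T_def U_def R_def \<eta>_def sum_nonneg)
  \<comment> \<open>Here \<open>4 * exp (6 * L)\<close> is
    \<open>1 / \<eta>\<^sup>2\<close>.\<close>
  also have "\<dots> = p\<^sup>2 * real (card I) * s * (1 / L\<^sup>2 + 1 / L)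
       + 4 * exp (6 * L) * (\<Sum>A\<in>Pow I. (a A - p ^ card A)\<^sup>2 * s ^ card A)"
    unfolding ER ET EU
    by (simp add: \<eta>_def power_divide exp_minus divide_simps flip: exp_of_nat_mult) (simp add: algebra_simps)
  finally show ?thesis unfolding N_def \<eta>_def .
qed

section \<open>Gibbs tail bound at a fixed size\<close>

lemma laplace_pos:
  assumes "prob_space \<mu>" "\<not> (AE x in \<mu>. x = \<infinity>)" "integrable \<mu> (boltzmann b)"
  shows "(\<integral>x. boltzmann b x \<partial>\<mu>) > 0"
proof -
  have "(\<integral>x. boltzmann b x \<partial>\<mu>) \<noteq> 0"
  proof
    assume "(\<integral>x. boltzmann b x \<partial>\<mu>) = 0"
    \<comment> \<open>The Boltzmann factor vanishes only at \<infinity>, so the weight would be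
      infinite almost surely.\<close>
    then have "AE x in \<mu>. boltzmann b x = 0"
      using assms(3) by (subst (asm) integral_nonneg_eq_0_iff_AE) (auto simp: boltzmann_nonneg)
    then have "AE x in \<mu>. x = \<infinity>"
      by eventually_elim (auto simp: boltzmann_def split: if_splits)
    with assms(2) show False by simp
  qed
  moreover have "(\<integral>x. boltzmann b x \<partial>\<mu>) \<ge> 0"
    by (intro integral_nonneg_AE) (simp add: boltzmann_nonneg)
  ultimately show ?thesis by linarith
qed

lemma boltzmann_square: "(boltzmann b x)\<^sup>2 = boltzmann (2 * b) x"
  by (simp add: boltzmann_def power2_eq_square algebra_simps flip: exp_add)

text \<open>A large Gibbs tail forces either a small \<open>N\<close> or a large \<open>H\<close>,
  up to a null set. The term \<open>r 2 - 2 * r 1 + 1\<close> is the planted mean of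
  \<open>(exp (- X) - 1)\<^sup>2\<close>. The free parameter \<open>L\<close> serves a two-stage
  limit: first the size grows with \<open>L\<close> fixed, then \<open>L\<close> is chosen large to
  control the first term.\<close>

lemma (in prob_space) gibbs_tail_probability_le:
  fixes V :: "'v set" and E :: "'v set set" and S :: "'v set set set"
    and \<omega> :: "'v set \<Rightarrow> 'a \<Rightarrow> ereal" and \<mu> :: "ereal measure"
    and m :: nat and \<beta> D \<epsilon> \<delta> \<rho> L :: real
  assumes G: "finite_graph V E" and SE: "S \<subseteq> Pow E" "S \<noteq> {}"
    and card: "\<And>\<pi>. \<pi> \<in> S \<Longrightarrow> card \<pi> = m" and m: "m > 0"
    and law: "prob_space \<mu>" "sets \<mu> = sets borel" "AE x in \<mu>. x \<noteq> -\<infinity>" "\<not> (AE x in \<mu>. x = \<infinity>)"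
    and law_exp: "\<And>b. b \<ge> 0 \<Longrightarrow> integrable \<mu> (boltzmann b)"
    and ind: "indep_vars (\<lambda>_. borel) \<omega> E" and distr: "\<And>e. e \<in> E \<Longrightarrow> distr M borel (\<omega> e) = \<mu>"
    and pos: "\<beta> \<ge> 0" "\<epsilon> > 0" "\<delta> > 0" "L > 0" and p: "0 \<le> p" "p \<le> 1 / 2"
    and matching: "\<And>A. A \<subseteq> E \<Longrightarrow> pairwise disjnt A \<Longrightarrow>
      \<bar>uniform_prob S {\<pi>. A \<subseteq> \<pi>} - p ^ card A\<bar> \<le> (\<rho> * p) ^ card A / sqrt m"
    and nonmatching: "\<And>A. A \<subseteq> E \<Longrightarrow> \<not> pairwise disjnt A \<Longrightarrow>
      \<bar>uniform_prob S {\<pi>. A \<subseteq> \<pi>} - p ^ card A\<bar> \<le> (\<rho> * p) ^ card A"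
  defines "lam \<equiv> \<lambda>b. \<integral>y. boltzmann b y \<partial>\<mu>"
  defines "s \<equiv> \<integral>y. (boltzmann \<beta> y / lam \<beta> - 1)\<^sup>2 \<partial>\<mu>"
    and "r \<equiv> \<lambda>j. (lam (\<beta> + j / real m) / lam \<beta>) ^ m * exp (- j * D)"
  defines "x \<equiv> (\<rho> * p)\<^sup>2 * s"
  shows "prob {x \<in> space M. measure (gibbs_measure S \<beta> (\<lambda>e. \<omega> e x))
            {\<pi> \<in> S. \<bar>total_weight (\<lambda>e. \<omega> e x) \<pi> / ereal (real m) + ereal D\<bar> > ereal \<epsilon>} > \<delta>}
    \<le> p\<^sup>2 * real (card E) * s * (1 / L\<^sup>2 + 1 / L)
      + 4 * exp (6 * L) * ((1 / m + 2 * real (card V) * real (card E) * x\<^sup>2) * exp (x * real (card E)))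
      + (r 2 - 2 * r 1 + 1) / ((1 - exp (- \<epsilon>))\<^sup>2 * \<delta> * (exp (- 3 * L) / 2))"
proof -
  interpret \<mu>: prob_space \<mu> by fact
  have fE: "finite E"
    using G by (intro finite_subset[of E "Pow V"]) (auto simp: finite_graph_def)
  have fS: "finite S" using SE fE finite_subset by auto
  have fin: "finite \<pi>" "\<pi> \<subseteq> E" if "\<pi> \<in> S" for \<pi> using that SE fE finite_subset by blast+
  have cS: "real (card S) > 0" using fS SE by (simp add: card_gt_0_iff)
  have lam_pos: "lam b > 0" if "b \<ge> 0" for b
    unfolding lam_def using laplace_pos law law_exp that by auto
  have \<omega>_meas: "\<omega> e \<in> borel_measurable M" if "e \<in> E" for e
    using ind that unfolding indep_vars_def by auto
  have b_meas: "boltzmann b \<in> borel_measurable borel" if "b \<ge> 0" for b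
    using borel_measurable_integrable[OF law_exp[OF that]] law(2) by (simp cong: measurable_cong_sets)
  have push: "integrable M (\<lambda>y. f (\<omega> e y))" "expectation (\<lambda>y. f (\<omega> e y)) = (\<integral>y. f y \<partial>\<mu>)"
    if "e \<in> E" "f \<in> borel_measurable borel" "integrable \<mu> f" for e and f :: "ereal \<Rightarrow> real"
    using that integrable_distr_eq[OF \<omega>_meas[OF that(1)], of f] integral_distr[OF \<omega>_meas[OF that(1)], of f]
    by (simp_all add: distr)

  define X where "X e y = boltzmann \<beta> (\<omega> e y) / lam \<beta> - 1" for e y
  have f1: "(\<lambda>y. boltzmann \<beta> y / lam \<beta> - 1) \<in> borel_measurable borel"
    using b_meas pos by simp
  have i1: "integrable \<mu> (\<lambda>y. boltzmann \<beta> y / lam \<beta> - 1)"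
    using law_exp pos by simp
  \<comment> \<open>Square integrability comes from the finite Laplace transform at
    \<open>2 * \<beta>\<close>.\<close>
  have i2: "integrable \<mu> (\<lambda>y. (boltzmann \<beta> y / lam \<beta> - 1)\<^sup>2)"
    using law_exp[of \<beta>] law_exp[of "2 * \<beta>"] pos
    by (simp add: power2_diff power_divide boltzmann_square)
  have s: "s \<ge> 0" unfolding s_def by simp
  have lam_\<beta>: "(\<integral>y. boltzmann \<beta> y \<partial>\<mu>) = lam \<beta>" by (simp add: lam_def)
  have X_int: "integrable M (X e)" "expectation (X e) = 0" if "e \<in> E" for e
    using push[OF that f1 i1] lam_pos[OF pos(1)] law_exp[OF pos(1)] lam_\<beta>
    by (simp_all add: X_def[abs_def] \<mu>.prob_space)
  have X_int2: "integrable M (\<lambda>y. (X e y)\<^sup>2)" "expectation (\<lambda>y. (X e y)\<^sup>2) = s" if "e \<in> E" for e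
    using push[OF that borel_measurable_power[OF f1, of 2] i2] by (simp_all add: X_def s_def)
  have X_ge: "X e y \<ge> - 1" for e y
    using lam_pos[OF pos(1)] boltzmann_nonneg[of \<beta>] by (simp add: X_def)
  have X_ind: "indep_vars (\<lambda>_. borel) X E"
    unfolding X_def[abs_def] by (rule indep_vars_compose2[OF ind]) (use f1 in simp)

  define N where "N y = (\<Sum>\<pi>\<in>S. \<Prod>e\<in>\<pi>. boltzmann \<beta> (\<omega> e y) / lam \<beta>) / real (card S)" for y
  have N: "N y = (\<Sum>A\<in>Pow E. uniform_prob S {\<pi>. A \<subseteq> \<pi>} * (\<Prod>e\<in>A. X e y))" for y
    using average_prod_eq_sum_uniform_prob[OF fE SE, of "\<lambda>e. X e y"] by (simp add: N_def X_def)
  have N_meas: "N \<in> borel_measurable M"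
  proof -
    have "X e \<in> borel_measurable M" if "e \<in> E" for e using X_int(1)[OF that] by auto
    then show ?thesis unfolding N[abs_def]
      by (intro borel_measurable_sum borel_measurable_times borel_measurable_const borel_measurable_prod) auto
  qed

  define q where "q j \<pi> y = (\<Prod>e\<in>\<pi>. boltzmann (\<beta> + j / real m) (\<omega> e y) * (exp (- j * D / real m) / lam \<beta>))"
    for j \<pi> y
  \<comment> \<open>By independence each of the \<open>m\<close> edges contributes the same factor,
    so the mean does not depend on \<pi> and survives averaging over \<open>S\<close>.\<close>
  have q: "integrable M (q j \<pi>)" "expectation (q j \<pi>) = r j" if "\<pi> \<in> S" "j \<ge> 0" for j \<pi>
  proof -
    have b: "\<beta> + j / real m \<ge> 0" using pos that by simp
    define f where "f y = boltzmann (\<beta> + j / real m) y * (exp (- j * D / real m) / lam \<beta>)" for y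
    have f: "f \<in> borel_measurable borel" "integrable \<mu> f"
      unfolding f_def[abs_def] using b_meas[OF b] law_exp[OF b] by auto
    have Ef: "(\<integral>y. f y \<partial>\<mu>) = lam (\<beta> + j / real m) * (exp (- j * D / real m) / lam \<beta>)"
      unfolding f_def lam_def by simp
    have qf: "q j \<pi> = (\<lambda>y. \<Prod>e\<in>\<pi>. f (\<omega> e y))" by (simp add: q_def f_def fun_eq_iff)
    note P = indep_vars_prod_expectation[OF fin(1)[OF that(1)]
        indep_vars_subset[OF ind fin(2)[OF that(1)]], of "\<lambda>_. f"]
    have e: "e \<in> E" if "e \<in> \<pi>" for e using fin(2)[OF \<open>\<pi> \<in> S\<close>] that by auto
    show "integrable M (q j \<pi>)" unfolding qf using P(1) f push(1)[OF e f] by auto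
    have "expectation (q j \<pi>) = (\<Prod>e\<in>\<pi>. expectation (\<lambda>y. f (\<omega> e y)))"
      unfolding qf using P(2) f push(1)[OF e f] by auto
    also have "\<dots> = (lam (\<beta> + j / real m) * (exp (- j * D / real m) / lam \<beta>)) ^ m"
      using push(2)[OF e f] Ef card[OF that(1)] by simp
    also have "\<dots> = (lam (\<beta> + j / real m) / lam \<beta>) ^ m * exp (- j * D / real m) ^ m"
      by (simp add: power_mult_distrib power_divide)
    also have "exp (- j * D / real m) ^ m = exp (- j * D)"
      using m by (simp flip: exp_of_nat_mult)
    finally show "expectation (q j \<pi>) = r j" by (simp add: r_def)
  qed
  have r0: "r 0 = 1" using lam_pos[OF pos(1)] by (simp add: r_def)

  define H where "H y = (\<Sum>\<pi>\<in>S. q 2 \<pi> y - 2 * q 1 \<pi> y + q 0 \<pi> y) / real (card S)" for y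
  have H_int: "integrable M H"
    unfolding H_def[abs_def] using q(1) by auto
  have EH: "expectation H = r 2 - 2 * r 1 + 1"
    unfolding H_def[abs_def] using q cS r0 by (simp add: Bochner_Integration.integral_sum)

  have ninf: "AE y in M. \<forall>e\<in>E. \<omega> e y \<noteq> -\<infinity>"
  proof (rule AE_finite_allI[OF fE])
    fix e assume e: "e \<in> E"
    have "AE y in distr M borel (\<omega> e). y \<noteq> -\<infinity>" unfolding distr[OF e] by (rule law(3))
    then show "AE y in M. \<omega> e y \<noteq> -\<infinity>"
      using \<omega>_meas[OF e] by (subst (asm) AE_distr_iff) auto
  qed
  \<comment> \<open>Weights avoid -\<infinity> only almost surely; off this null set the pointwise
    inequality \<open>tail\<close> is available.\<close>
  obtain Z where Z: "Z \<in> null_sets M" "{y \<in> space M. \<not> (\<forall>e\<in>E. \<omega> e y \<noteq> -\<infinity>)} \<subseteq> Z"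
    using ninf by (auto elim!: AE_E simp: null_sets_def)

  define T where "T y = measure (gibbs_measure S \<beta> (\<lambda>e. \<omega> e y))
            {\<pi> \<in> S. \<bar>total_weight (\<lambda>e. \<omega> e y) \<pi> / ereal (real m) + ereal D\<bar> > ereal \<epsilon>}" for y
  define \<eta> where "\<eta> = exp (- 3 * L) / 2"
  define \<kappa> where "\<kappa> = (1 - exp (- \<epsilon>))\<^sup>2"
  have \<eta>: "\<eta> > 0" and \<kappa>: "\<kappa> > 0" using pos by (auto simp: \<eta>_def \<kappa>_def)
  have tail: "\<kappa> * T y * N y \<le> H y" if "\<forall>e\<in>E. \<omega> e y \<noteq> -\<infinity>" "N y > 0" for y
    using gibbs_tail_le(1)[OF fE SE card m lam_pos[OF pos(1)] pos(2), of "\<lambda>e. \<omega> e y" \<beta> D] that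
    unfolding \<kappa>_def T_def H_def q_def N_def by auto
  have "H y \<ge> 0" if "\<forall>e\<in>E. \<omega> e y \<noteq> -\<infinity>" for y
    using gibbs_tail_le(2)[OF fE SE card m lam_pos[OF pos(1)] pos(2), of "\<lambda>e. \<omega> e y" \<beta> D] that
    unfolding H_def q_def by auto
  with ninf have H_nonneg: "AE y in M. H y \<ge> 0" by auto
  \<comment> \<open>The covering sets are measurable, which is all that monotonicity of
    \<open>prob\<close> asks.\<close>
  have sub: "{y \<in> space M. T y > \<delta>} \<subseteq>
      Z \<union> {y \<in> space M. N y < \<eta>} \<union> {y \<in> space M. \<kappa> * \<delta> * \<eta> \<le> H y}"
  proof safe
    fix y assume y: "y \<in> space M" "T y > \<delta>" "\<not> \<kappa> * \<delta> * \<eta> \<le> H y" "y \<notin> Z"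
    show "N y < \<eta>"
    proof (rule ccontr)
      assume "\<not> N y < \<eta>"
      then have n: "N y \<ge> \<eta>" by simp
      have "\<kappa> * \<delta> * \<eta> \<le> \<kappa> * T y * N y"
        using n y(2) \<kappa> \<eta> pos by (intro mult_mono) auto
      also have "\<dots> \<le> H y" using tail[of y] Z(2) y n \<eta> by auto
      finally show False using y(3) by simp
    qed
  qed
  have ev: "Z \<in> events" "{y \<in> space M. N y < \<eta>} \<in> events" "{y \<in> space M. \<kappa> * \<delta> * \<eta> \<le> H y} \<in> events"
    using Z N_meas borel_measurable_integrable[OF H_int] by auto
  have "prob {y \<in> space M. T y > \<delta>} \<le>
      prob (Z \<union> {y \<in> space M. N y < \<eta>} \<union> {y \<in> space M. \<kappa> * \<delta> * \<eta> \<le> H y})"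
    by (rule finite_measure_mono[OF sub]) (use ev in auto)
  also have "\<dots> \<le> prob Z + prob {y \<in> space M. N y < \<eta>} + prob {y \<in> space M. \<kappa> * \<delta> * \<eta> \<le> H y}"
    using ev by (intro order_trans[OF measure_Un_le] add_mono order_refl) auto
  also have "prob Z = 0" using Z(1) by (simp add: null_sets_def measure_def)
  also have "prob {y \<in> space M. \<kappa> * \<delta> * \<eta> \<le> H y} \<le> expectation H / (\<kappa> * \<delta> * \<eta>)"
    using H_nonneg \<kappa> \<eta> pos by (intro integral_Markov_inequality_measure[where A="space M"] H_int) auto
  also have "prob {y \<in> space M. N y < \<eta>} \<le> p\<^sup>2 * real (card E) * s * (1 / L\<^sup>2 + 1 / L)
       + 4 * exp (6 * L) * (\<Sum>A\<in>Pow E. (uniform_prob S {\<pi>. A \<subseteq> \<pi>} - p ^ card A)\<^sup>2 * s ^ card A)"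
    unfolding N \<eta>_def
    by (rule multilinear_lower_tail[OF fE X_ind X_int(1) X_int2(1) X_int(2) X_int2(2) X_ge p pos(4)])
  also have "(\<Sum>A\<in>Pow E. (uniform_prob S {\<pi>. A \<subseteq> \<pi>} - p ^ card A)\<^sup>2 * s ^ card A)
      \<le> (1 / m + 2 * real (card V) * real (card E) * x\<^sup>2) * exp (x * real (card E))"
    unfolding x_def using m s p matching nonmatching by (intro sum_square_deviation_le[OF G fE]) auto
  finally show ?thesis
    by (simp add: EH T_def \<eta>_def \<kappa>_def)
qed

section \<open>Asymptotics\<close>

text \<open>The expression is \<open>j\<close> times a difference quotient with step
  \<open>j / m n\<close>. The step is eventually positive and tends to 0, so the points approach
  \<beta> from the right within \<open>{0..}\<close>.\<close>

lemma tendsto_scaled_increment: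
  fixes f :: "real \<Rightarrow> real" and m :: "nat \<Rightarrow> real"
  assumes f: "(f has_real_derivative D) (at \<beta> within {0..})" and "\<beta> \<ge> 0" "j > 0"
    and m: "filterlim m at_top sequentially"
  shows "(\<lambda>n. m n * (f (\<beta> + j / m n) - f \<beta>)) \<longlonglongrightarrow> j * D"
proof -
  have m0: "\<forall>\<^sub>F n in sequentially. m n > 0"
    using m by (simp add: filterlim_at_top_dense)
  have "(\<lambda>n. j / m n) \<longlonglongrightarrow> 0"
    by (rule real_tendsto_divide_at_top[OF tendsto_const m])
  then have "(\<lambda>n. \<beta> + j / m n) \<longlonglongrightarrow> \<beta> + 0" by (intro tendsto_add tendsto_const)
  then have "filterlim (\<lambda>n. \<beta> + j / m n) (at \<beta> within {0..}) sequentially"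
    unfolding filterlim_at using m0 assms(2,3) by (auto elim!: eventually_mono)
  then have "(\<lambda>n. (f (\<beta> + j / m n) - f \<beta>) / ((\<beta> + j / m n) - \<beta>)) \<longlonglongrightarrow> D"
    using f unfolding has_field_derivative_iff by (rule filterlim_compose[rotated])
  then have "(\<lambda>n. j * ((f (\<beta> + j / m n) - f \<beta>) / ((\<beta> + j / m n) - \<beta>))) \<longlonglongrightarrow> j * D"
    by (intro tendsto_mult tendsto_const)
  then show ?thesis
    by (rule Lim_transform_eventually) (use m0 \<open>j > 0\<close> in \<open>auto elim!: eventually_mono\<close>)
qed

theorem corollary2p8:
  fixes V :: "nat \<Rightarrow> 'v set"
    and E :: "nat \<Rightarrow> 'v set set"
    and c :: nat
    and S :: "nat \<Rightarrow> 'v set set set"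
    and m :: "nat \<Rightarrow> nat"
    and \<gamma> :: real
    and \<mu> :: "ereal measure"
    and M :: "nat \<Rightarrow> 'w measure"
    and \<omega> :: "nat \<Rightarrow> 'v set \<Rightarrow> 'w \<Rightarrow> ereal"
    and \<beta> D :: real
  assumes graph: "\<And>n. n \<ge> 1 \<Longrightarrow> finite_graph (V n) (E n)"
    and edge_trans: "\<And>n. n \<ge> 1 \<Longrightarrow> edge_transitive (V n) (E n)"
    and card_V: "\<And>n. n \<ge> 1 \<Longrightarrow> card (V n) = c * n"
    and card_E: "(\<lambda>n. real (card (E n))) \<in> \<Theta>(\<lambda>n. (real (card (V n)))\<^sup>2)"
    and law: "prob_space \<mu>" "sets \<mu> = sets borel"
    and law_ninf: "AE x in \<mu>. x \<noteq> -\<infinity>"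
    and law_pinf: "\<not> (AE x in \<mu>. x = \<infinity>)"
    and law_exp: "\<And>b. b \<ge> 0 \<Longrightarrow> integrable \<mu> (boltzmann b)"
    and prob_M: "\<And>n. n \<ge> 1 \<Longrightarrow> prob_space (M n)"
    and indep: "\<And>n. n \<ge> 1 \<Longrightarrow> prob_space.indep_vars (M n) (\<lambda>_. borel) (\<omega> n) (E n)"
    and distr: "\<And>n e. n \<ge> 1 \<Longrightarrow> e \<in> E n \<Longrightarrow> distr (M n) borel (\<omega> n e) = \<mu>"
    and S_sub: "\<And>n. n \<ge> 1 \<Longrightarrow> S n \<subseteq> Pow (E n)"
    and S_ne: "\<And>n. n \<ge> 1 \<Longrightarrow> S n \<noteq> {}"
    and S_card: "\<And>n \<pi>. n \<ge> 1 \<Longrightarrow> \<pi> \<in> S n \<Longrightarrow> card \<pi> = m n"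
    and gamma_pos: "\<gamma> > 0"
    and m_lim: "(\<lambda>n. (real (m n))\<^sup>2 / (2 * real (card (E n)))) \<longlonglongrightarrow> \<gamma>"
    and extend: "\<And>n \<Gamma>. n \<ge> 1 \<Longrightarrow> partial_matching (E n) \<Gamma> \<Longrightarrow> \<exists>\<pi>\<in>S n. \<Gamma> \<subseteq> \<pi>"
    and matching_corr: "\<exists>\<rho>>0. \<forall>n\<ge>1. \<forall>k. \<forall>\<Gamma>. partial_matching (E n) \<Gamma> \<and> card \<Gamma> = k \<longrightarrow>
          \<bar>uniform_prob (S n) {\<pi>. \<Gamma> \<subseteq> \<pi>} / (\<Prod>e\<in>\<Gamma>. uniform_prob (S n) {\<pi>. e \<in> \<pi>}) - 1\<bar>
            \<le> \<rho> ^ k / sqrt (real (m n))"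
    and nonmatching_corr: "\<exists>\<rho>>0. \<forall>n\<ge>1. \<forall>k. \<forall>\<Gamma>\<in>subset_closure (S n).
          \<not> partial_matching (E n) \<Gamma> \<and> card \<Gamma> = k \<longrightarrow>
          uniform_prob (S n) {\<pi>. \<Gamma> \<subseteq> \<pi>} \<le> \<rho> ^ k * (\<Prod>e\<in>\<Gamma>. uniform_prob (S n) {\<pi>. e \<in> \<pi>})"
    and edge_prob: "\<And>n e. n \<ge> 1 \<Longrightarrow> e \<in> E n \<Longrightarrow>
          uniform_prob (S n) {\<pi>. e \<in> \<pi>} = real (m n) / real (card (E n))"
    and beta: "\<beta> \<ge> 0"
    and deriv: "(log_laplace \<mu> has_real_derivative D) (at \<beta> within {0..})"
  shows "\<forall>\<epsilon>>0. \<forall>\<delta>>0.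
    (\<lambda>n. measure (M n) {x \<in> space (M n).
        measure (gibbs_measure (S n) \<beta> (\<lambda>e. \<omega> n e x))
          {\<pi> \<in> S n. \<bar>total_weight (\<lambda>e. \<omega> n e x) \<pi> / ereal (real (m n)) + ereal D\<bar> > ereal \<epsilon>} > \<delta>})
      \<longlonglongrightarrow> 0"
proof (intro allI impI)
  fix \<epsilon> \<delta> :: real assume \<epsilon>: "\<epsilon> > 0" and \<delta>: "\<delta> > 0"
  define P where "P n = measure (M n) {x \<in> space (M n).
        measure (gibbs_measure (S n) \<beta> (\<lambda>e. \<omega> n e x))
          {\<pi> \<in> S n. \<bar>total_weight (\<lambda>e. \<omega> n e x) \<pi> / ereal (real (m n)) + ereal D\<bar> > ereal \<epsilon>} > \<delta>}" for n
  define N where "N n = real (card (E n))" for n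
  \<comment> \<open>For \<open>N n > 0\<close> this is \<open>(p n)\<^sup>2 * N n\<close>, the scale
    of every second moment below; it tends to \<open>2 * \<gamma>\<close>.\<close>
  define v where "v n = (real (m n))\<^sup>2 / N n" for n
  define p where "p n = real (m n) / N n" for n
  define lam where "lam = (\<lambda>b. \<integral>y. boltzmann b y \<partial>\<mu>)"
  define s where "s = (\<integral>y. (boltzmann \<beta> y / lam \<beta> - 1)\<^sup>2 \<partial>\<mu>)"
  define r where "r n j = (lam (\<beta> + j / real (m n)) / lam \<beta>) ^ m n * exp (- j * D)" for n j
  have s: "s \<ge> 0" by (simp add: s_def)

  \<comment> \<open>With \<open>c = 0\<close> there would be no edges, and since division by zero
    returns 0 the limit would be 0 instead of \<gamma>.\<close>
  have "c \<noteq> 0"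
  proof
    assume "c = 0"
    have "E n = {}" if "n \<ge> 1" for n
      using graph[OF that] card_V[OF that] \<open>c = 0\<close> by (auto simp: finite_graph_def)
    then have "\<forall>\<^sub>F n in sequentially. (real (m n))\<^sup>2 / (2 * real (card (E n))) = 0"
      by (intro eventually_sequentiallyI[of 1]) simp
    then have "(\<lambda>n. (real (m n))\<^sup>2 / (2 * real (card (E n)))) \<longlonglongrightarrow> 0"
      by (rule tendsto_eventually)
    with m_lim gamma_pos show False using LIMSEQ_unique by fastforce
  qed
  have V_top: "filterlim (\<lambda>n. real (card (V n))) at_top sequentially"
  proof (rule filterlim_at_top_mono[OF filterlim_real_sequentially])
    show "\<forall>\<^sub>F n in sequentially. real n \<le> real (card (V n))"
      using card_V \<open>c \<noteq> 0\<close> by (intro eventually_sequentiallyI[of 1]) auto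
  qed
  \<comment> \<open>The quadratic lower bound on the number of edges makes
    \<open>card V / card E\<close> vanish, and with it the contribution of the
    non-matchings.\<close>
  obtain k where k: "k > 0" "\<forall>\<^sub>F n in sequentially. N n \<ge> k * (real (card (V n)))\<^sup>2"
    using card_E unfolding N_def by (auto dest!: bigthetaD2 elim!: landau_omega.bigE)
  have V1: "\<forall>\<^sub>F n in sequentially. real (card (V n)) \<ge> 1"
    using V_top unfolding filterlim_at_top by blast
  have N_top: "filterlim N at_top sequentially"
  proof (rule filterlim_at_top_mono)
    show "filterlim (\<lambda>n. k * (real (card (V n)))\<^sup>2) at_top sequentially"
      by (intro filterlim_tendsto_pos_mult_at_top[OF tendsto_const k(1)] filterlim_pow_at_top V_top) simp
  qed (use k in auto)
  have N_pos: "\<forall>\<^sub>F n in sequentially. N n > 0"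
    using N_top by (simp add: filterlim_at_top_dense)
  have VN: "(\<lambda>n. real (card (V n)) / N n) \<longlonglongrightarrow> 0"
  proof (rule tendsto_sandwich[OF _ _ tendsto_const])
    show "(\<lambda>n. (1 / k) / real (card (V n))) \<longlonglongrightarrow> 0"
      by (rule real_tendsto_divide_at_top[OF tendsto_const V_top])
    show "\<forall>\<^sub>F n in sequentially. real (card (V n)) / N n \<le> (1 / k) / real (card (V n))"
      using k(2) N_pos V1
    proof eventually_elim
      case (elim n)
      then show ?case using k(1) by (simp add: field_simps power2_eq_square)
    qed
  qed (auto simp: N_def)
  have v: "v \<longlonglongrightarrow> 2 * \<gamma>"
    using tendsto_mult[OF tendsto_const m_lim, of 2] by (simp add: v_def[abs_def] N_def)
  have m_top: "filterlim (\<lambda>n. real (m n)) at_top sequentially"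
  proof -
    have "filterlim (\<lambda>n. sqrt (v n * N n)) at_top sequentially"
      using gamma_pos
      by (intro filterlim_compose[OF sqrt_at_top] filterlim_tendsto_pos_mult_at_top[OF v _ N_top]) simp
    moreover have "\<forall>\<^sub>F n in sequentially. sqrt (v n * N n) = real (m n)"
      using N_pos by eventually_elim (simp add: v_def)
    ultimately show ?thesis by (rule filterlim_cong[OF refl refl, THEN iffD1, rotated])
  qed
  have m_pos: "\<forall>\<^sub>F n in sequentially. m n > 0"
    using m_top by (auto simp: filterlim_at_top_dense dest: spec[of _ 0])
  have m_inv: "(\<lambda>n. 1 / real (m n)) \<longlonglongrightarrow> 0"
    by (rule real_tendsto_divide_at_top[OF tendsto_const m_top])
  have "(\<lambda>n. v n * (1 / real (m n))) \<longlonglongrightarrow> 2 * \<gamma> * 0"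
    by (intro tendsto_mult v m_inv)
  moreover have "(\<lambda>n. v n * (1 / real (m n))) = p"
    by (simp add: v_def p_def power2_eq_square fun_eq_iff)
  ultimately have "p \<longlonglongrightarrow> 0" by (simp only: mult_zero_right)
  then have p_half: "\<forall>\<^sub>F n in sequentially. p n \<le> 1 / 2"
    by (auto dest: order_tendstoD(2)[where a="1/2"] elim!: eventually_mono)

  have lam: "lam b = exp (log_laplace \<mu> b)" if "b \<ge> 0" for b
    using laplace_pos[OF law(1) law_pinf law_exp[OF that]] by (simp add: lam_def log_laplace_def)
  \<comment> \<open>The \<open>m n\<close>-th power of the ratio is the exponential of
    \<open>m n\<close> times an increment of \<open>log_laplace\<close>; this exponent tends to
    \<open>j * D\<close>, which the centring \<open>- j * D\<close> cancels.\<close>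
  have r: "(\<lambda>n. r n j) \<longlonglongrightarrow> 1" if "j > 0" for j
  proof -
    have "(\<lambda>n. exp (real (m n) * (log_laplace \<mu> (\<beta> + j / real (m n)) - log_laplace \<mu> \<beta>) + - j * D))
        \<longlonglongrightarrow> exp (j * D + - j * D)"
      by (intro tendsto_exp tendsto_add tendsto_const tendsto_scaled_increment[OF deriv beta that m_top])
    moreover have "exp (real (m n) * (log_laplace \<mu> (\<beta> + j / real (m n)) - log_laplace \<mu> \<beta>) + - j * D) = r n j" for n
      using beta that by (simp only: exp_add exp_of_nat_mult exp_diff) (simp add: r_def lam)
    ultimately show ?thesis by simp
  qed

  obtain \<rho>1 where \<rho>1: "\<rho>1 > 0" "\<And>n A. n \<ge> 1 \<Longrightarrow> partial_matching (E n) A \<Longrightarrow>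
      \<bar>uniform_prob (S n) {\<pi>. A \<subseteq> \<pi>} / (\<Prod>e\<in>A. uniform_prob (S n) {\<pi>. e \<in> \<pi>}) - 1\<bar>
        \<le> \<rho>1 ^ card A / sqrt (real (m n))"
    using matching_corr by blast
  obtain \<rho>2 where \<rho>2: "\<rho>2 > 0" "\<And>n A. n \<ge> 1 \<Longrightarrow> A \<in> subset_closure (S n) \<Longrightarrow> \<not> partial_matching (E n) A \<Longrightarrow>
      uniform_prob (S n) {\<pi>. A \<subseteq> \<pi>} \<le> \<rho>2 ^ card A * (\<Prod>e\<in>A. uniform_prob (S n) {\<pi>. e \<in> \<pi>})"
    using nonmatching_corr by blast
  \<comment> \<open>One constant for both estimates; being at least 1, it also makes
    \<open>(\<rho> * p n) ^ card A\<close> dominate \<open>p n ^ card A\<close>.\<close>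
  define \<rho> where "\<rho> = max 1 (max \<rho>1 \<rho>2)"
  have prod_p: "(\<Prod>e\<in>A. uniform_prob (S n) {\<pi>. e \<in> \<pi>}) = p n ^ card A" if "n \<ge> 1" "A \<subseteq> E n" for n A
  proof -
    have "(\<Prod>e\<in>A. uniform_prob (S n) {\<pi>. e \<in> \<pi>}) = (\<Prod>e\<in>A. p n)"
      using that edge_prob[OF that(1)] by (intro prod.cong) (auto simp: p_def N_def)
    then show ?thesis by simp
  qed
  have matching: "\<bar>uniform_prob (S n) {\<pi>. A \<subseteq> \<pi>} - p n ^ card A\<bar> \<le> (\<rho> * p n) ^ card A / sqrt (real (m n))"
    if "n \<ge> 1" "p n > 0" "A \<subseteq> E n" "pairwise disjnt A" for n A
  proof -
    have pk: "p n ^ card A > 0" using that by simp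
    have "\<bar>uniform_prob (S n) {\<pi>. A \<subseteq> \<pi>} - p n ^ card A\<bar>
        = p n ^ card A * \<bar>uniform_prob (S n) {\<pi>. A \<subseteq> \<pi>} / p n ^ card A - 1\<bar>"
    proof -
      have "uniform_prob (S n) {\<pi>. A \<subseteq> \<pi>} - p n ^ card A
          = p n ^ card A * (uniform_prob (S n) {\<pi>. A \<subseteq> \<pi>} / p n ^ card A - 1)"
        using \<open>p n > 0\<close> by (simp add: right_diff_distrib)
      then show ?thesis by (simp only: abs_mult abs_of_pos[OF pk])
    qed
    also have "\<dots> \<le> p n ^ card A * (\<rho>1 ^ card A / sqrt (real (m n)))"
      using \<rho>1(2)[OF that(1), of A] that pk prod_p[OF that(1,3)]
      by (intro mult_left_mono) (auto simp: partial_matching_def)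
    also have "\<dots> \<le> p n ^ card A * (\<rho> ^ card A / sqrt (real (m n)))"
      using pk \<rho>1(1) by (intro mult_left_mono divide_right_mono power_mono) (auto simp: \<rho>_def)
    finally show ?thesis by (simp add: power_mult_distrib mult.commute)
  qed
  have nonmatching: "\<bar>uniform_prob (S n) {\<pi>. A \<subseteq> \<pi>} - p n ^ card A\<bar> \<le> (\<rho> * p n) ^ card A"
    if n: "n \<ge> 1" "p n > 0" "A \<subseteq> E n" "\<not> pairwise disjnt A" for n A
  proof -
    have pk: "p n ^ card A > 0" using that by simp
    have u0: "uniform_prob (S n) {\<pi>. A \<subseteq> \<pi>} \<ge> 0" by (simp add: uniform_prob_def)
    have "uniform_prob (S n) {\<pi>. A \<subseteq> \<pi>} \<le> \<rho>2 ^ card A * p n ^ card A"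
    proof (cases "A \<in> subset_closure (S n)")
      case True
      then show ?thesis using \<rho>2(2)[OF n(1) True] n prod_p[OF n(1,3)] by (auto simp: partial_matching_def)
    next
      \<comment> \<open>A set contained in no configuration lies outside the reach of the
        correlation hypothesis, but its inclusion probability is 0.\<close>
      case False
      have "finite (E n)"
        using graph[OF n(1)] by (intro finite_subset[of "E n" "Pow (V n)"]) (auto simp: finite_graph_def)
      then have "finite (S n)" using S_sub[OF n(1)] finite_subset by auto
      moreover have "{\<pi> \<in> S n. A \<subseteq> \<pi>} = {}" using False by (auto simp: subset_closure_def)
      ultimately have "uniform_prob (S n) {\<pi>. A \<subseteq> \<pi>} = 0"
        using S_ne[OF n(1)] by (simp add: uniform_prob_eq)
      then show ?thesis using pk \<rho>2(1) by simp
    qed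
    also have "\<dots> \<le> \<rho> ^ card A * p n ^ card A"
      using pk \<rho>2(1) by (intro mult_right_mono power_mono) (auto simp: \<rho>_def)
    finally have "uniform_prob (S n) {\<pi>. A \<subseteq> \<pi>} \<le> \<rho> ^ card A * p n ^ card A" .
    moreover have "1 * p n ^ card A \<le> \<rho> ^ card A * p n ^ card A"
      using pk by (intro mult_right_mono one_le_power) (auto simp: \<rho>_def)
    \<comment> \<open>Both numbers lie between 0 and \<open>(\<rho> * p n) ^ card A\<close>, hence
      so does their distance.\<close>
    ultimately show ?thesis using u0 pk unfolding power_mult_distrib by linarith
  qed

  \<comment> \<open>The fixed-size bound, rewritten in quantities whose limits are known.\<close>
  define B where "B L n = v n * s * (1 / L\<^sup>2 + 1 / L)
      + 4 * exp (6 * L) * ((1 / real (m n) + 2 * (real (card (V n)) / N n) * (\<rho>\<^sup>2 * s * v n)\<^sup>2) * exp (\<rho>\<^sup>2 * s * v n))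
      + (r n 2 - 2 * r n 1 + 1) / ((1 - exp (- \<epsilon>))\<^sup>2 * \<delta> * (exp (- 3 * L) / 2))" for L n
  have PB: "\<forall>\<^sub>F n in sequentially. P n \<le> B L n" if L: "L > 0" for L
    using N_pos m_pos p_half eventually_ge_at_top[of 1]
  proof eventually_elim
    case (elim n)
    note n = elim(4)
    interpret M: prob_space "M n" by (rule prob_M[OF n])
    have pn: "p n > 0" using elim by (simp add: p_def)
    have pv: "(p n)\<^sup>2 * N n = v n"
      using elim by (simp add: p_def v_def power2_eq_square)
    have xN: "(\<rho> * p n)\<^sup>2 * s * N n = \<rho>\<^sup>2 * s * v n"
      by (simp add: power_mult_distrib flip: pv)
    have xV: "2 * real (card (V n)) * N n * ((\<rho> * p n)\<^sup>2 * s)\<^sup>2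
        = 2 * (real (card (V n)) / N n) * (\<rho>\<^sup>2 * s * v n)\<^sup>2"
      using elim unfolding xN[symmetric] by (simp add: power2_eq_square)
    have "P n \<le> (p n)\<^sup>2 * N n * s * (1 / L\<^sup>2 + 1 / L)
      + 4 * exp (6 * L) * ((1 / real (m n) + 2 * real (card (V n)) * N n * ((\<rho> * p n)\<^sup>2 * s)\<^sup>2)
          * exp ((\<rho> * p n)\<^sup>2 * s * N n))
      + (r n 2 - 2 * r n 1 + 1) / ((1 - exp (- \<epsilon>))\<^sup>2 * \<delta> * (exp (- 3 * L) / 2))"
      unfolding P_def s_def r_def lam_def N_def
      by (rule M.gibbs_tail_probability_le[OF graph[OF n] S_sub[OF n] S_ne[OF n] S_card[OF n] elim(2)
            law law_ninf law_pinf law_exp indep[OF n] distr[OF n] beta \<epsilon> \<delta> L less_imp_le[OF pn] elim(3)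
            matching[OF n pn] nonmatching[OF n pn]])
    then show "P n \<le> B L n" unfolding pv xN xV B_def .
  qed
  \<comment> \<open>Only the first term survives: \<open>1 / m n\<close> and
    \<open>card (V n) / N n\<close> vanish, and the planted second moment tends to
    \<open>1 - 2 + 1\<close>.\<close>
  have B: "B L \<longlonglongrightarrow> 2 * \<gamma> * s * (1 / L\<^sup>2 + 1 / L)" for L
  proof -
    have "B L \<longlonglongrightarrow> 2 * \<gamma> * s * (1 / L\<^sup>2 + 1 / L)
      + 4 * exp (6 * L) * ((0 + 2 * 0 * (\<rho>\<^sup>2 * s * (2 * \<gamma>))\<^sup>2) * exp (\<rho>\<^sup>2 * s * (2 * \<gamma>)))
      + (1 - 2 * 1 + 1) * inverse ((1 - exp (- \<epsilon>))\<^sup>2 * \<delta> * (exp (- 3 * L) / 2))"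
      unfolding B_def divide_inverse[of "r _ 2 - _ + _"]
      by (intro tendsto_intros v m_inv VN r) auto
    then show ?thesis by simp
  qed
  have "P \<longlonglongrightarrow> 0"
  proof (rule order_tendstoI)
    fix a :: real assume "a < 0"
    then show "\<forall>\<^sub>F n in sequentially. a < P n"
      by (intro always_eventually allI) (auto simp: P_def intro: less_le_trans)
  next
    fix a :: real assume a: "a > 0"
    \<comment> \<open>For \<open>L \<ge> 1\<close> the limit of \<open>B L\<close> is at most
      \<open>4 * \<gamma> * s / L\<close>; the summand 1 ensures \<open>L \<ge> 1\<close> and makes
      this strictly less than \<open>a\<close>.\<close>
    define L where "L = 4 * \<gamma> * s / a + 1"
    have L: "L \<ge> 1" using a s gamma_pos by (simp add: L_def)
    then have "L\<^sup>2 \<ge> L" by (simp add: power2_eq_square)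
    then have "2 * \<gamma> * s * (1 / L\<^sup>2 + 1 / L) \<le> 2 * \<gamma> * s * (1 / L + 1 / L)"
      using L s gamma_pos by (intro mult_left_mono add_right_mono divide_left_mono) auto
    also have "\<dots> = 4 * \<gamma> * s / L" by simp
    also have "\<dots> < a"
      using a L by (simp add: L_def field_simps)
    finally have "\<forall>\<^sub>F n in sequentially. B L n < a"
      by (rule order_tendstoD(2)[OF B])
    moreover have "\<forall>\<^sub>F n in sequentially. P n \<le> B L n" using PB L by simp
    ultimately show "\<forall>\<^sub>F n in sequentially. P n < a"
      by eventually_elim simp
  qed
  then show "(\<lambda>n. measure (M n) {x \<in> space (M n).
        measure (gibbs_measure (S n) \<beta> (\<lambda>e. \<omega> n e x))
          {\<pi> \<in> S n. \<bar>total_weight (\<lambda>e. \<omega> n e x) \<pi> / ereal (real (m n)) + ereal D\<bar> > ereal \<epsilon>} > \<delta>})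
      \<longlonglongrightarrow> 0"
    unfolding P_def .
qed

end
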